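(* Let $-1<\rho<1$, let $R=\begin{pmatrix}1&\rho\\ \rho&1\end{pmatrix}$, let $\theta\in\mathbb{R}$ and $\boldsymbol{\theta}=(\theta_1,\theta_2)^T$ with $\theta_1=\theta_2=\theta$, and let $\mathbf{X}=(X_1,X_2)^T\sim SN_2(\boldsymbol{\theta},R)$ be bivariate skew normal. Let $F_1,F_2$ be the marginal distribution functions of $X_1,X_2$, and for $u\in(0,1)$ let $\lambda_L(u)=P\bigl(X_1\le F_1^{-1}(u)\mid X_2\le F_2^{-1}(u)\bigr)$. Then, as $u\to 0^+$: (a) if $\theta>0$, $$ \lambda_L(u)\sim u^{\beta^2}\,\frac{\alpha^3}{\pi\lambda^4\beta(1+\beta^2)^2}\sqrt{\frac{2}{\pi}}\,(2\pi\lambda)^{1+\beta^2}\left(\frac{1+\lambda^2}{2}\right)^{\frac32}\,[-\log u]^{\beta^2-\frac12}, $$ where $$ \lambda=\frac{\theta(1+\rho)}{\sqrt{1+\theta^2(1-\rho^2)}},\qquad \alpha=\frac{\theta(1+\rho)}{\sqrt{1+2\theta^2(1+\rho)}},\qquad \beta=\sqrt{\frac{(1-\rho)\bigl(1+2\theta^2(1+\rho)\bigr)}{1+\rho}}; $$ (b) if $\theta<0$, $$ \lambda_L(u)\sim u^{\frac{1-\rho}{1+\rho}}\cdot\frac{1+\rho}{2}\sqrt{\frac{1+\rho}{1-\rho}}\,(-\pi\log u)^{-\frac{\rho}{1+\rho}}. $$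
   Context: $\mathbf{X}\sim SN_2(\boldsymbol{\theta},R)$ means that $\mathbf{X}$ has probability density $f(\mathbf{x})=2\phi_2(\mathbf{x},R)\,\Phi(\boldsymbol{\theta}^T\mathbf{x})$, $\mathbf{x}\in\mathbb{R}^2$, where $\phi_2(\cdot,R)$ is the density of the bivariate normal distribution with mean $\mathbf{0}$ and correlation (covariance) matrix $R$, and $\Phi$ is the cumulative distribution function of the univariate standard normal distribution. $F_i^{-1}$ is the inverse function of $F_i$ on $(0,1)$. The notation $f(u)\sim g(u)$ as $u\to 0^+$ means $f(u)/g(u)\to 1$ as $u\to 0^+$. *)

theory Defs
  imports "HOL-Probability.Probability" "HOL-Library.Landau_Symbols"
begin

text \<open>
  Density on \<open>\<real>\<^sup>2\<close> of the centred normal distribution with covariance matrix \<open>R\<close>;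
  meaningful for symmetric positive definite \<open>R\<close>.
\<close>
definition bivariate_normal_density :: "real^2^2 \<Rightarrow> real^2 \<Rightarrow> real" where
  "bivariate_normal_density R x =
     exp (- (x \<bullet> (matrix_inv R *v x)) / 2) / (2 * pi * sqrt (det R))"

definition skew_normal_density :: "real^2 \<Rightarrow> real^2^2 \<Rightarrow> real^2 \<Rightarrow> real" where
  "skew_normal_density \<theta> R x =
     2 * bivariate_normal_density R x * cdf std_normal_distribution (\<theta> \<bullet> x)"

definition skew_normal_distributed ::
    "'a measure \<Rightarrow> ('a \<Rightarrow> real^2) \<Rightarrow> real^2 \<Rightarrow> real^2^2 \<Rightarrow> bool" where
  "skew_normal_distributed M X \<theta> R \<longleftrightarrow>
     distributed M lborel X (\<lambda>x. ennreal (skew_normal_density \<theta> R x))"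

definition marginal_cdf :: "'a measure \<Rightarrow> ('a \<Rightarrow> real^2) \<Rightarrow> 2 \<Rightarrow> real \<Rightarrow> real" where
  "marginal_cdf M X i = cdf (distr M borel (\<lambda>\<omega>. X \<omega> $ i))"

text \<open>
  The inverse \<open>inv\<close> is only used at levels \<open>u \<in> {0<..<1}\<close>; it is the genuine
  inverse there when the marginal distribution functions are bijections from \<open>\<real>\<close>
  onto \<open>{0<..<1}\<close>, as is the case for skew normal vectors.
\<close>
definition lower_tail_dependence ::
    "'a measure \<Rightarrow> ('a \<Rightarrow> real^2) \<Rightarrow> real \<Rightarrow> real" where
  "lower_tail_dependence M X u =
     \<P>(\<omega> in M. X \<omega> $ 1 \<le> inv (marginal_cdf M X 1) u
              \<bar> X \<omega> $ 2 \<le> inv (marginal_cdf M X 2) u)"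

end

theory Submission
  imports Defs "HOL-Real_Asymp.Real_Asymp"
begin

text \<open>
  Let \<open>Phi\<close> be the standard normal distribution function, \<open>s = x + y\<close> and \<open>d = x - y\<close>. In these
  coordinates the density of \<open>X\<close> is a constant times \<open>Phi (\<theta> s)\<close> times the exponential of
  \<open>- s\<^sup>2 / (4 (1 + \<rho>)) - d\<^sup>2 / (4 (1 - \<rho>))\<close>. It is symmetric in \<open>x\<close> and \<open>y\<close>, so both margins have
  one distribution function \<open>F\<close>, and with \<open>t = - F\<^sup>-\<^sup>1(u)\<close> we have
  \<open>\<lambda>\<^sub>L(u) = P(X\<^sub>1 \<le> -t, X\<^sub>2 \<le> -t) / u\<close>. Three ingredients give its asymptotics.

  Tails. On the quadrant \<open>x, y \<le> -t\<close> put \<open>x = -t - p/t\<close> and \<open>y = -t - q/t\<close>. A Gaussian factor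
  \<open>exp (- K s\<^sup>2 / 4)\<close> becomes \<open>exp (- K t\<^sup>2) exp (- K p) exp (- K q)\<close> up to a factor that tends to 1 and
  never exceeds 1, while the \<open>d\<^sup>2\<close> term disappears in the limit. By dominated convergence only the
  integral \<open>1 / K\<^sup>2\<close> of a product of exponentials survives. The same substitution in one variable
  treats the margins, whose density is again skew normal, with parameter \<open>lam\<close>: integrating out \<open>y\<close>
  averages \<open>Phi\<close> over a normal law. Hence \<open>F(-t)\<close> and the quadrant probability are asymptotic to
  \<open>A t\<^sup>-\<^sup>m exp (- B t\<^sup>2)\<close> and \<open>D t\<^sup>-\<^sup>n exp (- K t\<^sup>2)\<close>.

  The sign of \<open>\<theta>\<close>. For \<open>\<theta> < 0\<close> the skewing factor tends to 1 in the lower tail. For \<open>\<theta> > 0\<close> it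
  decays like a Gaussian divided by its argument (Mills' ratio), which raises \<open>K\<close>, \<open>B\<close>, \<open>m\<close> and
  \<open>n\<close>. Both cases fit one pattern, a Gaussian times a factor decaying like a negative power; this
  is what the predicate \<open>regularly_decaying\<close> captures. Mills' ratio is itself an instance of the
  one-dimensional tail lemma, so one dominated convergence argument per dimension suffices.

  Inversion. If \<open>u = F(-t)\<close>, then \<open>- ln u\<close> is asymptotic to \<open>B t\<^sup>2\<close>, but \<open>exp (- K t\<^sup>2)\<close> cannot be
  recovered from that alone. Instead the relation \<open>u \<sim> A t\<^sup>-\<^sup>m exp (- B t\<^sup>2)\<close> is raised to the power
  \<open>\<gamma> = K / B\<close>, which eliminates the exponential exactly; the logarithm is used only in the
  remaining power of \<open>t\<close> (lemma \<open>asymp_equiv_at_gaussian_quantile\<close>). What is left is to identify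
  the constants.
\<close>

section \<open>Tails of Gaussian-type integrals\<close>

lemma lborel_integral_affine:
  fixes f :: "'a::euclidean_space \<Rightarrow> real"
  assumes [measurable]: "f \<in> borel_measurable borel" and "c \<noteq> 0"
  shows "(\<integral>x. f x \<partial>lborel) = \<bar>c\<bar> ^ DIM('a) * (\<integral>x. f (a + c *\<^sub>R x) \<partial>lborel)"
proof -
  have "(\<integral>x. f x \<partial>lborel)
      = (\<integral>x. f x \<partial>density (distr lborel borel (\<lambda>x. a + c *\<^sub>R x)) (\<lambda>_. ennreal (\<bar>c\<bar> ^ DIM('a))))"
    using lborel_affine[OF assms(2), of a] by (simp add: ennreal_power)
  also have "\<dots> = (\<integral>x. \<bar>c\<bar> ^ DIM('a) * f x \<partial>distr lborel borel (\<lambda>x. a + c *\<^sub>R x))"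
    by (subst integral_real_density) auto
  also have "\<dots> = \<bar>c\<bar> ^ DIM('a) * (\<integral>x. f (a + c *\<^sub>R x) \<partial>lborel)"
    by (subst integral_distr) auto
  finally show ?thesis .
qed

text \<open>
  The limit describes \<open>r\<close> near infinity and fixes the constant of the tail integrals below; the
  bound on the whole positive axis supplies their dominating functions.
\<close>
definition regularly_decaying :: "(real \<Rightarrow> real) \<Rightarrow> nat \<Rightarrow> real \<Rightarrow> real \<Rightarrow> bool" where
  "regularly_decaying r k C c \<longleftrightarrow>
     r \<in> borel_measurable borel \<and> (\<forall>z. 0 \<le> r z) \<and> (\<forall>z>0. z ^ k * r z \<le> C) \<and>
     ((\<lambda>z. z ^ k * r z) \<longlongrightarrow> c) at_top"

lemma regularly_decayingI:
  assumes "r \<in> borel_measurable borel" "\<And>z. 0 \<le> r z" "\<And>z. 0 < z \<Longrightarrow> z ^ k * r z \<le> C"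
    and "((\<lambda>z. z ^ k * r z) \<longlongrightarrow> c) at_top"
  shows "regularly_decaying r k C c"
  using assms by (simp add: regularly_decaying_def)

lemma
  assumes "regularly_decaying r k C c"
  shows regularly_decaying_measurable: "r \<in> borel_measurable borel"
    and regularly_decaying_nonneg: "0 \<le> r z"
    and regularly_decaying_bound: "0 < z \<Longrightarrow> z ^ k * r z \<le> C"
    and regularly_decaying_limit: "((\<lambda>z. z ^ k * r z) \<longlongrightarrow> c) at_top"
  using assms by (simp_all add: regularly_decaying_def)

text \<open>
  The tail integrals evaluate \<open>r\<close> at \<open>m t + q / t\<close>, with \<open>m = 1\<close> on the line and \<open>m = 2\<close> in the
  plane. Since \<open>q \<ge> 0\<close>, the weight \<open>(m t)^k\<close> is at most the weight the bound on \<open>r\<close> can absorb.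
\<close>
lemma shifted_bound:
  assumes rd: "regularly_decaying r k C c"
    and "0 < t" "0 < m" "0 \<le> q"
  shows "t ^ k * r (m * t + q / t) \<le> C / m ^ k"
proof -
  have "(m * t) ^ k * r (m * t + q / t) \<le> (m * t + q / t) ^ k * r (m * t + q / t)"
    using assms by (intro mult_right_mono power_mono regularly_decaying_nonneg[OF rd]) auto
  also have "\<dots> \<le> C"
    using assms by (intro regularly_decaying_bound[OF rd] add_pos_nonneg) auto
  finally show ?thesis
    using assms by (simp add: power_mult_distrib field_simps)
qed

lemma shifted_limit:
  assumes rd: "regularly_decaying r k C c"
    and "0 < m"
  shows "((\<lambda>t. t ^ k * r (m * t + q / t)) \<longlongrightarrow> c / m ^ k) at_top"
proof -
  have lim: "filterlim (\<lambda>t. m * t + q / t) at_top at_top"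
    using assms by real_asymp
  have "((\<lambda>t. (t / (m * t + q / t)) ^ k) \<longlongrightarrow> (1 / m) ^ k) at_top"
    using assms by (intro tendsto_power) (real_asymp simp: field_simps)
  then have "((\<lambda>t. (t / (m * t + q / t)) ^ k * ((m * t + q / t) ^ k * r (m * t + q / t)))
      \<longlongrightarrow> (1 / m) ^ k * c) at_top"
    by (intro tendsto_mult filterlim_compose[OF regularly_decaying_limit[OF rd] lim])
  moreover have "\<forall>\<^sub>F t in at_top. (t / (m * t + q / t)) ^ k * ((m * t + q / t) ^ k * r (m * t + q / t))
       = t ^ k * r (m * t + q / t)"
    using eventually_compose_filterlim[OF eventually_gt_at_top[of 0] lim]
    by eventually_elim (simp add: power_divide)
  ultimately show ?thesis
    by (simp add: power_divide Lim_transform_eventually)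
qed

lemma
  assumes "0 < l"
  shows integrable_exponential_density: "integrable lborel (exponential_density l)"
    and integral_exponential_density: "(\<integral>x. exponential_density l x \<partial>lborel) = 1"
proof -
  have *: "(\<integral>\<^sup>+x. ennreal (exponential_density l x) \<partial>lborel) = ennreal 1"
    using prob_space.emeasure_space_1[OF prob_space_exponential_density[OF assms]]
    by (simp add: emeasure_density)
  show "integrable lborel (exponential_density l)"
    using * assms by (intro integrableI_nn_integral_finite[of _ _ 1])
     (auto simp: exponential_density_nonneg)
  show "(\<integral>x. exponential_density l x \<partial>lborel) = 1"
    using * assms by (subst integral_eq_nn_integral) (auto simp: exponential_density_nonneg)
qed

text \<open>
  The substitution \<open>x = - t - p / t\<close> is chosen so that the cross term of
  \<open>B x\<^sup>2 = B t\<^sup>2 + 2 B p + B p\<^sup>2 / t\<^sup>2\<close> does not depend on \<open>t\<close>: it turns into an exponential density.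
  The argument of \<open>r\<close> is written with the factor 1 to match \<open>shifted_bound\<close> and \<open>shifted_limit\<close>.
\<close>
lemma gaussian_tail_scaled:
  assumes rd: "regularly_decaying r k C c"
    and "0 < B" "0 < t"
  shows "t ^ (k + 1) * exp (B * t\<^sup>2) * (\<integral>x. indicator {..-t} x * (exp (- (B * x\<^sup>2)) * r (- x)) \<partial>lborel)
    = (\<integral>p. exponential_density (2 * B) p *
         (exp (- (B * p\<^sup>2 / t\<^sup>2)) * (t ^ k * r (1 * t + p / t)) / (2 * B)) \<partial>lborel)"
proof -
  note [measurable] = regularly_decaying_measurable[OF rd]
  have "(\<integral>x. indicator {..-t} x * (exp (- (B * x\<^sup>2)) * r (- x)) \<partial>lborel)
      = \<bar>- (1 / t)\<bar> ^ DIM(real) * (\<integral>p. indicator {..-t} (- t + (- (1 / t)) *\<^sub>R p)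
          * (exp (- (B * (- t + (- (1 / t)) *\<^sub>R p)\<^sup>2)) * r (- (- t + (- (1 / t)) *\<^sub>R p))) \<partial>lborel)"
    using assms by (intro lborel_integral_affine) auto
  then have "t ^ (k + 1) * exp (B * t\<^sup>2) * (\<integral>x. indicator {..-t} x * (exp (- (B * x\<^sup>2)) * r (- x)) \<partial>lborel)
     = (\<integral>p. t ^ k * exp (B * t\<^sup>2) * (indicator {..-t} (- t + (- (1 / t)) *\<^sub>R p)
          * (exp (- (B * (- t + (- (1 / t)) *\<^sub>R p)\<^sup>2)) * r (- (- t + (- (1 / t)) *\<^sub>R p)))) \<partial>lborel)"
    using assms by simp
  also have "\<dots> = (\<integral>p. exponential_density (2 * B) p *
         (exp (- (B * p\<^sup>2 / t\<^sup>2)) * (t ^ k * r (1 * t + p / t)) / (2 * B)) \<partial>lborel)"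
  proof (intro Bochner_Integration.integral_cong refl)
    fix p :: real
    have sq: "B * (- t + - (1 / t) * p)\<^sup>2 = B * t\<^sup>2 + p * (2 * B) + B * p\<^sup>2 / t\<^sup>2"
      using assms by (simp add: field_simps power2_eq_square)
    have ex: "exp (B * t\<^sup>2) * exp (- (B * (- t + - (1 / t) * p)\<^sup>2))
        = exp (- p * (2 * B)) * exp (- (B * p\<^sup>2 / t\<^sup>2))"
      unfolding sq by (simp flip: exp_add)
    have ind: "indicator {..-t} (- t + - (1 / t) * p) = (if p < 0 then 0 else 1 :: real)"
      using assms by (auto simp: indicator_def field_simps)
    have "t ^ k * exp (B * t\<^sup>2) * (indicator {..-t} (- t + (- (1 / t)) *\<^sub>R p)
          * (exp (- (B * (- t + (- (1 / t)) *\<^sub>R p)\<^sup>2)) * r (- (- t + (- (1 / t)) *\<^sub>R p))))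
       = (if p < 0 then 0 else 1) * t ^ k * (exp (B * t\<^sup>2) * exp (- (B * (- t + - (1 / t) * p)\<^sup>2))) * r (t + p / t)"
      unfolding real_scaleR_def ind by (simp add: add.commute)
    also have "\<dots> = exponential_density (2 * B) p *
         (exp (- (B * p\<^sup>2 / t\<^sup>2)) * (t ^ k * r (1 * t + p / t)) / (2 * B))"
      unfolding ex using assms by (simp add: exponential_density_def)
    finally show "t ^ k * exp (B * t\<^sup>2) * (indicator {..-t} (- t + (- (1 / t)) *\<^sub>R p)
          * (exp (- (B * (- t + (- (1 / t)) *\<^sub>R p)\<^sup>2)) * r (- (- t + (- (1 / t)) *\<^sub>R p)))) = \<dots>" .
  qed
  finally show ?thesis .
qed

lemma gaussian_tail_integrand_bound:
  assumes rd: "regularly_decaying r k C c"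
    and "0 < B" "0 < t"
  shows "0 \<le> exponential_density (2 * B) p * (exp (- (B * p\<^sup>2 / t\<^sup>2)) * (t ^ k * r (1 * t + p / t)) / (2 * B))"
    and "exponential_density (2 * B) p * (exp (- (B * p\<^sup>2 / t\<^sup>2)) * (t ^ k * r (1 * t + p / t)) / (2 * B))
      \<le> exponential_density (2 * B) p * (C / (2 * B))"
proof -
  show "0 \<le> exponential_density (2 * B) p * (exp (- (B * p\<^sup>2 / t\<^sup>2)) * (t ^ k * r (1 * t + p / t)) / (2 * B))"
    using assms regularly_decaying_nonneg[OF rd] by (simp add: exponential_density_nonneg)
  show "exponential_density (2 * B) p * (exp (- (B * p\<^sup>2 / t\<^sup>2)) * (t ^ k * r (1 * t + p / t)) / (2 * B))
      \<le> exponential_density (2 * B) p * (C / (2 * B))"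
  proof (cases "p < 0")
    case True then show ?thesis by (simp add: exponential_density_def)
  next
    case False
    have "exp (- (B * p\<^sup>2 / t\<^sup>2)) * (t ^ k * r (1 * t + p / t)) \<le> 1 * (C / 1 ^ k)"
      using False assms regularly_decaying_nonneg[OF rd] by (intro mult_mono shifted_bound[OF rd]) auto
    then show ?thesis
      using assms by (intro mult_left_mono divide_right_mono) (auto simp: exponential_density_nonneg)
  qed
qed

text \<open>
  Dominated convergence in the scaled integral: the factor \<open>exp (- B p\<^sup>2 / t\<^sup>2)\<close> tends to 1, and the
  exponential density integrates to 1.
\<close>
lemma gaussian_tail_limit:
  assumes rd: "regularly_decaying r k C c"
    and "0 < B"
  shows "((\<lambda>t. t ^ (k + 1) * exp (B * t\<^sup>2) *
      (\<integral>x. indicator {..-t} x * (exp (- (B * x\<^sup>2)) * r (- x)) \<partial>lborel)) \<longlongrightarrow> c / (2 * B)) at_top"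
proof -
  note [measurable] = regularly_decaying_measurable[OF rd]
  have "((\<lambda>t. (\<integral>p. exponential_density (2 * B) p *
         (exp (- (B * p\<^sup>2 / t\<^sup>2)) * (t ^ k * r (1 * t + p / t)) / (2 * B)) \<partial>lborel))
     \<longlongrightarrow> (\<integral>p. exponential_density (2 * B) p * (exp 0 * (c / 1 ^ k) / (2 * B)) \<partial>lborel)) at_top"
  proof (rule integral_dominated_convergence_at_top)
    show "integrable lborel (\<lambda>p. exponential_density (2 * B) p * (C / (2 * B)))"
      using assms by (intro integrable_mult_left integrable_exponential_density) auto
    show "\<forall>\<^sub>F t in at_top. AE p in lborel. norm (exponential_density (2 * B) p *
         (exp (- (B * p\<^sup>2 / t\<^sup>2)) * (t ^ k * r (1 * t + p / t)) / (2 * B)))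
         \<le> exponential_density (2 * B) p * (C / (2 * B))"
      using eventually_gt_at_top[of 0]
      by eventually_elim
        (intro AE_I2, simp only: real_norm_def abs_of_nonneg gaussian_tail_integrand_bound[OF assms])
    show "AE p in lborel. ((\<lambda>t. exponential_density (2 * B) p *
         (exp (- (B * p\<^sup>2 / t\<^sup>2)) * (t ^ k * r (1 * t + p / t)) / (2 * B)))
         \<longlongrightarrow> exponential_density (2 * B) p * (exp 0 * (c / 1 ^ k) / (2 * B))) at_top"
    proof (intro AE_I2 tendsto_mult_left tendsto_divide tendsto_const tendsto_mult tendsto_exp shifted_limit[OF rd])
      fix p :: real
      show "((\<lambda>t. - (B * p\<^sup>2 / t\<^sup>2)) \<longlongrightarrow> 0) at_top" by real_asymp
    qed (use assms in auto)
  qed auto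
  also have "(\<integral>p. exponential_density (2 * B) p * (exp 0 * (c / 1 ^ k) / (2 * B)) \<partial>lborel) = c / (2 * B)"
    using assms by (simp add: integral_exponential_density)
  finally show ?thesis
    by (rule Lim_transform_eventually)
       (use eventually_gt_at_top[of 0] in eventually_elim, simp only: gaussian_tail_scaled[OF assms])
qed

text \<open>
  The domination holds for each single \<open>t\<close>, not only in the limit; this yields the bound that
  makes Mills' ratio \<open>regularly_decaying\<close> again.
\<close>
lemma gaussian_tail_bound:
  assumes rd: "regularly_decaying r k C c"
    and "0 < B" "0 < t"
  shows "t ^ (k + 1) * exp (B * t\<^sup>2) *
      (\<integral>x. indicator {..-t} x * (exp (- (B * x\<^sup>2)) * r (- x)) \<partial>lborel) \<le> C / (2 * B)"
proof -
  have "0 \<le> exponential_density (2 * B) p * (C / (2 * B))" for p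
    using gaussian_tail_integrand_bound[OF assms, of p] by linarith
  then have "(\<integral>p. exponential_density (2 * B) p *
         (exp (- (B * p\<^sup>2 / t\<^sup>2)) * (t ^ k * r (1 * t + p / t)) / (2 * B)) \<partial>lborel)
      \<le> (\<integral>p. exponential_density (2 * B) p * (C / (2 * B)) \<partial>lborel)"
    using assms gaussian_tail_integrand_bound[OF assms]
    by (intro integral_mono' integrable_mult_left integrable_exponential_density)
       (simp_all del: times_divide_eq_right)
  then show ?thesis
    using assms by (simp only: gaussian_tail_scaled[OF assms]) (simp add: integral_exponential_density)
qed

lemma
  assumes "0 < l"
  shows integrable_exponential_density_pair:
      "integrable lborel (\<lambda>z. exponential_density l (fst z) * exponential_density l (snd z))"
    and integral_exponential_density_pair:
      "(\<integral>z. exponential_density l (fst z) * exponential_density l (snd z) \<partial>lborel) = 1"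
proof -
  have int: "integrable (lborel \<Otimes>\<^sub>M lborel) (\<lambda>z. exponential_density l (fst z) * exponential_density l (snd z))"
    using assms
    by (intro lborel_pair.Fubini_integrable)
       (auto simp: integrable_exponential_density integral_exponential_density abs_mult
          exponential_density_nonneg)
  then show "integrable lborel (\<lambda>z. exponential_density l (fst z) * exponential_density l (snd z))"
    by (simp add: lborel_prod)
  have "(\<integral>z. exponential_density l (fst z) * exponential_density l (snd z) \<partial>(lborel \<Otimes>\<^sub>M lborel))
     = (\<integral>x. \<integral>y. exponential_density l x * exponential_density l y \<partial>lborel \<partial>lborel)"
    by (subst lborel_pair.integral_fst'[symmetric, OF int]) simp
  then show "(\<integral>z. exponential_density l (fst z) * exponential_density l (snd z) \<partial>lborel) = 1"
    using assms by (simp add: lborel_prod integral_exponential_density)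
qed

lemma borel_measurable_fst_snd [measurable]:
  "(fst :: real \<times> real \<Rightarrow> real) \<in> borel_measurable borel"
  "(snd :: real \<times> real \<Rightarrow> real) \<in> borel_measurable borel"
  by (auto intro!: borel_measurable_continuous_onI continuous_intros)

text \<open>
  Here \<open>x = - t - p / t\<close> and \<open>y = - t - q / t\<close>. The sum \<open>x + y\<close> carries the growing part, while
  \<open>x - y = (q - p) / t\<close> vanishes in the limit.
\<close>
lemma gaussian_quadrant_scaled:
  assumes rd: "regularly_decaying r k C c"
    and "0 < K" "0 < t"
  shows "t ^ (k + 2) * exp (K * t\<^sup>2) *
      (\<integral>z. indicator ({..-t} \<times> {..-t}) z *
         (exp (- (K / 4 * (fst z + snd z)\<^sup>2 + E * (fst z - snd z)\<^sup>2)) * r (- (fst z + snd z))) \<partial>lborel)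
    = (\<integral>z. exponential_density K (fst z) * exponential_density K (snd z) *
         (exp (- ((K / 4 * (fst z + snd z)\<^sup>2 + E * (fst z - snd z)\<^sup>2) / t\<^sup>2))
            * (t ^ k * r (2 * t + (fst z + snd z) / t)) / K\<^sup>2) \<partial>lborel)"
proof -
  note [measurable] = regularly_decaying_measurable[OF rd]
  define F where "F = (\<lambda>z :: real \<times> real. indicator ({..-t} \<times> {..-t}) z *
     (exp (- (K / 4 * (fst z + snd z)\<^sup>2 + E * (fst z - snd z)\<^sup>2)) * r (- (fst z + snd z))))"
  have [measurable]: "F \<in> borel_measurable borel"
  proof -
    have "indicator ({..-t} \<times> {..-t}) \<in> borel_measurable (borel :: (real \<times> real) measure)"
      by (intro borel_measurable_indicator borel_closed closed_Times) auto
    then show ?thesis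
      unfolding F_def by measurable
  qed
  have "(\<integral>z. F z \<partial>lborel) = \<bar>- (1 / t)\<bar> ^ DIM(real \<times> real) * (\<integral>z. F ((-t, -t) + (- (1 / t)) *\<^sub>R z) \<partial>lborel)"
    using assms by (intro lborel_integral_affine) auto
  also have "\<dots> = (\<integral>z. F ((-t, -t) + (- (1 / t)) *\<^sub>R z) \<partial>lborel) / t\<^sup>2"
    using assms by (simp add: power2_eq_square)
  finally have "t ^ (k + 2) * exp (K * t\<^sup>2) * (\<integral>z. F z \<partial>lborel)
     = (\<integral>z. t ^ k * exp (K * t\<^sup>2) * F ((-t, -t) + (- (1 / t)) *\<^sub>R z) \<partial>lborel)"
    using assms by (simp add: power2_eq_square)
  also have "\<dots> = (\<integral>z. exponential_density K (fst z) * exponential_density K (snd z) *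
         (exp (- ((K / 4 * (fst z + snd z)\<^sup>2 + E * (fst z - snd z)\<^sup>2) / t\<^sup>2))
            * (t ^ k * r (2 * t + (fst z + snd z) / t)) / K\<^sup>2) \<partial>lborel)"
  proof (intro Bochner_Integration.integral_cong refl)
    fix z :: "real \<times> real"
    obtain p q where z: "z = (p, q)" by (cases z)
    have affine: "(-t, -t) + (- (1 / t)) *\<^sub>R z = (- t - p / t, - t - q / t)"
      by (simp add: z)
    have expo: "K / 4 * (- t - p / t + (- t - q / t))\<^sup>2 + E * (- t - p / t - (- t - q / t))\<^sup>2
        = K * t\<^sup>2 + p * K + q * K + (K / 4 * (p + q)\<^sup>2 + E * (p - q)\<^sup>2) / t\<^sup>2"
      using assms by (simp add: field_simps power2_eq_square)
    have ex: "exp (K * t\<^sup>2) * exp (- (K / 4 * (- t - p / t + (- t - q / t))\<^sup>2 + E * (- t - p / t - (- t - q / t))\<^sup>2))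
        = exp (- p * K) * exp (- q * K) * exp (- ((K / 4 * (p + q)\<^sup>2 + E * (p - q)\<^sup>2) / t\<^sup>2))"
      unfolding expo by (simp flip: exp_add)
    have arg: "- (- t - p / t + (- t - q / t)) = 2 * t + (p + q) / t"
      by (simp add: add_divide_distrib)
    have ind: "indicator ({..-t} \<times> {..-t}) (- t - p / t, - t - q / t)
        = (if p < 0 then 0 else 1) * (if q < 0 then 0 else 1 :: real)"
      using assms by (auto simp: indicator_def field_simps)
    have "t ^ k * exp (K * t\<^sup>2) * F ((-t, -t) + (- (1 / t)) *\<^sub>R z)
       = (if p < 0 then 0 else 1) * (if q < 0 then 0 else 1) * t ^ k *
          (exp (K * t\<^sup>2) * exp (- (K / 4 * (- t - p / t + (- t - q / t))\<^sup>2 + E * (- t - p / t - (- t - q / t))\<^sup>2)))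
          * r (2 * t + (p + q) / t)"
      unfolding affine F_def fst_conv snd_conv ind arg by (simp only: mult_ac)
    also have "\<dots> = exponential_density K (fst z) * exponential_density K (snd z) *
         (exp (- ((K / 4 * (fst z + snd z)\<^sup>2 + E * (fst z - snd z)\<^sup>2) / t\<^sup>2))
            * (t ^ k * r (2 * t + (fst z + snd z) / t)) / K\<^sup>2)"
      unfolding ex using assms by (simp add: z exponential_density_def power2_eq_square)
    finally show "t ^ k * exp (K * t\<^sup>2) * F ((-t, -t) + (- (1 / t)) *\<^sub>R z) = \<dots>" .
  qed
  finally show ?thesis
    unfolding F_def .
qed

lemma gaussian_quadrant_limit:
  assumes rd: "regularly_decaying r k C c"
    and "0 < K" "0 \<le> E"
  shows "((\<lambda>t. t ^ (k + 2) * exp (K * t\<^sup>2) *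
      (\<integral>z. indicator ({..-t} \<times> {..-t}) z *
         (exp (- (K / 4 * (fst z + snd z)\<^sup>2 + E * (fst z - snd z)\<^sup>2)) * r (- (fst z + snd z))) \<partial>lborel))
     \<longlongrightarrow> c / (2 ^ k * K\<^sup>2)) at_top"
proof -
  note [measurable] = regularly_decaying_measurable[OF rd]
  let ?e = "\<lambda>z :: real \<times> real. exponential_density K (fst z) * exponential_density K (snd z)"
  let ?h = "\<lambda>t z :: real \<times> real. exp (- ((K / 4 * (fst z + snd z)\<^sup>2 + E * (fst z - snd z)\<^sup>2) / t\<^sup>2))
            * (t ^ k * r (2 * t + (fst z + snd z) / t)) / K\<^sup>2"
  have e_nonneg: "0 \<le> ?e z" for z
    using assms by (simp add: exponential_density_nonneg)
  have "((\<lambda>t. (\<integral>z. ?e z * ?h t z \<partial>lborel)) \<longlongrightarrow> (\<integral>z. ?e z * (exp 0 * (c / 2 ^ k) / K\<^sup>2) \<partial>lborel)) at_top"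
  proof (rule integral_dominated_convergence_at_top)
    show "integrable lborel (\<lambda>z. ?e z * (C / 2 ^ k / K\<^sup>2))"
      using assms by (intro integrable_mult_left integrable_exponential_density_pair) auto
    have bound: "norm (?e z * ?h t z) \<le> ?e z * (C / 2 ^ k / K\<^sup>2)" if "0 < t" for t z
    proof (cases "fst z < 0 \<or> snd z < 0")
      case True
      then have "?e z = 0" by (auto simp: exponential_density_def)
      then show ?thesis by (simp only: mult_zero_left norm_zero)
    next
      case False
      have "exp (- ((K / 4 * (fst z + snd z)\<^sup>2 + E * (fst z - snd z)\<^sup>2) / t\<^sup>2))
            * (t ^ k * r (2 * t + (fst z + snd z) / t)) \<le> 1 * (C / 2 ^ k)"
        using False assms regularly_decaying_nonneg[OF rd] that by (intro mult_mono shifted_bound[OF rd]) auto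
      then have "?e z * ?h t z \<le> ?e z * (C / 2 ^ k / K\<^sup>2)"
        using assms e_nonneg by (intro mult_left_mono divide_right_mono) auto
      moreover have "0 \<le> ?e z * ?h t z"
        using that regularly_decaying_nonneg[OF rd] e_nonneg by (intro mult_nonneg_nonneg[OF e_nonneg] divide_nonneg_nonneg) auto
      ultimately show ?thesis
        by (simp only: real_norm_def abs_of_nonneg)
    qed
    show "\<forall>\<^sub>F t in at_top. AE z in lborel. norm (?e z * ?h t z) \<le> ?e z * (C / 2 ^ k / K\<^sup>2)"
      using eventually_gt_at_top[of 0] by eventually_elim (intro AE_I2 bound)
    show "AE z in lborel. ((\<lambda>t. ?e z * ?h t z) \<longlongrightarrow> ?e z * (exp 0 * (c / 2 ^ k) / K\<^sup>2)) at_top"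
    proof (intro AE_I2 tendsto_mult_left tendsto_divide tendsto_const tendsto_mult tendsto_exp shifted_limit[OF rd])
      fix z :: "real \<times> real"
      show "((\<lambda>t. - ((K / 4 * (fst z + snd z)\<^sup>2 + E * (fst z - snd z)\<^sup>2) / t\<^sup>2)) \<longlongrightarrow> 0) at_top"
        by real_asymp
    qed (use assms in auto)
  qed simp_all
  also have "(\<integral>z. ?e z * (exp 0 * (c / 2 ^ k) / K\<^sup>2) \<partial>lborel) = c / (2 ^ k * K\<^sup>2)"
    using assms by (subst integral_mult_left_zero) (simp add: integral_exponential_density_pair)
  finally show ?thesis
    by (rule Lim_transform_eventually)
       (use eventually_gt_at_top[of 0] in eventually_elim, simp only: gaussian_quadrant_scaled[OF assms(1,2)])
qed

section \<open>The standard normal distribution function\<close>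

abbreviation std_normal_cdf :: "real \<Rightarrow> real" where
  "std_normal_cdf \<equiv> cdf std_normal_distribution"

lemma std_normal_cdf_nonneg: "0 \<le> std_normal_cdf x"
  by (simp add: cdf_def2)

lemma std_normal_cdf_le_1: "std_normal_cdf x \<le> 1"
  by (intro real_distribution.cdf_bounded_prob real_dist_normal_dist)

lemma tendsto_std_normal_cdf_at_top: "(std_normal_cdf \<longlongrightarrow> 1) at_top"
  by (intro real_distribution.cdf_lim_at_top_prob real_dist_normal_dist)

lemma borel_measurable_std_normal_cdf [measurable]: "std_normal_cdf \<in> borel_measurable borel"
  by (intro borel_measurable_mono monoI finite_borel_measure.cdf_nondecreasing
        real_distribution.finite_borel_measure_M real_dist_normal_dist)

lemma std_normal_cdf_eq_integral:
  "std_normal_cdf x = (\<integral>y. indicator {..x} y * std_normal_density y \<partial>lborel)"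
proof -
  have "emeasure std_normal_distribution {..x} = (\<integral>\<^sup>+y. ennreal (indicator {..x} y * std_normal_density y) \<partial>lborel)"
    by (auto simp: emeasure_density indicator_def intro!: nn_integral_cong)
  then show ?thesis
    unfolding cdf_def2 measure_def by (subst integral_eq_nn_integral) auto
qed

text \<open>
  The standard normal distribution function is a Gaussian tail integral with constant weight, so
  these are the case \<open>k = 0\<close>, \<open>B = 1/2\<close> of the tail lemmas.
\<close>
lemma
  shows mills_ratio_bound: "0 < t \<Longrightarrow> t * exp (t\<^sup>2 / 2) * std_normal_cdf (- t) \<le> 1 / sqrt (2 * pi)"
    and mills_ratio_limit:
      "((\<lambda>t. t * exp (t\<^sup>2 / 2) * std_normal_cdf (- t)) \<longlongrightarrow> 1 / sqrt (2 * pi)) at_top"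
proof -
  have rd: "regularly_decaying (\<lambda>_. 1 / sqrt (2 * pi)) 0 (1 / sqrt (2 * pi)) (1 / sqrt (2 * pi))"
    by (rule regularly_decayingI) auto
  have eq: "t ^ (0 + 1) * exp (1 / 2 * t\<^sup>2) *
     (\<integral>x. indicator {..-t} x * (exp (- (1 / 2 * x\<^sup>2)) * (1 / sqrt (2 * pi))) \<partial>lborel)
      = t * exp (t\<^sup>2 / 2) * std_normal_cdf (- t)" for t :: real
    unfolding std_normal_cdf_eq_integral by (simp add: std_normal_density_def mult.commute)
  show "0 < t \<Longrightarrow> t * exp (t\<^sup>2 / 2) * std_normal_cdf (- t) \<le> 1 / sqrt (2 * pi)"
    using gaussian_tail_bound[OF rd, of "1 / 2" t] unfolding eq by simp
  show "((\<lambda>t. t * exp (t\<^sup>2 / 2) * std_normal_cdf (- t)) \<longlongrightarrow> 1 / sqrt (2 * pi)) at_top"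
    using gaussian_tail_limit[OF rd, of "1 / 2"] unfolding eq by simp
qed

text \<open>
  The Gaussian part of \<open>std_normal_cdf (- \<kappa> z)\<close> is split off so that it can be merged with the
  exponent of the normal density; Mills' ratio leaves a remainder of order \<open>1 / z\<close>.
\<close>
lemma regularly_decaying_std_normal_cdf_pos:
  assumes "0 < \<kappa>"
  shows "regularly_decaying (\<lambda>z. exp (\<kappa>\<^sup>2 * z\<^sup>2 / 2) * std_normal_cdf (- \<kappa> * z)) 1
           (1 / (\<kappa> * sqrt (2 * pi))) (1 / (\<kappa> * sqrt (2 * pi)))"
proof (rule regularly_decayingI)
  have eq: "z ^ 1 * (exp (\<kappa>\<^sup>2 * z\<^sup>2 / 2) * std_normal_cdf (- \<kappa> * z))
      = \<kappa> * z * exp ((\<kappa> * z)\<^sup>2 / 2) * std_normal_cdf (- (\<kappa> * z)) / \<kappa>" for z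
    using assms by (simp add: power_mult_distrib)
  show "z ^ 1 * (exp (\<kappa>\<^sup>2 * z\<^sup>2 / 2) * std_normal_cdf (- \<kappa> * z)) \<le> 1 / (\<kappa> * sqrt (2 * pi))"
    if "0 < z" for z
    unfolding eq using mills_ratio_bound[of "\<kappa> * z"] assms that by (simp add: field_simps)
  have "filterlim (\<lambda>z. \<kappa> * z) at_top at_top"
    using assms by real_asymp
  from filterlim_compose[OF mills_ratio_limit this]
  have "((\<lambda>z. \<kappa> * z * exp ((\<kappa> * z)\<^sup>2 / 2) * std_normal_cdf (- (\<kappa> * z)) / \<kappa>)
     \<longlongrightarrow> 1 / sqrt (2 * pi) / \<kappa>) at_top"
    using assms by (intro tendsto_divide tendsto_const) auto
  then show "((\<lambda>z. z ^ 1 * (exp (\<kappa>\<^sup>2 * z\<^sup>2 / 2) * std_normal_cdf (- \<kappa> * z)))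
      \<longlongrightarrow> 1 / (\<kappa> * sqrt (2 * pi))) at_top"
    unfolding eq by (simp add: mult.commute)
qed (auto simp: std_normal_cdf_nonneg)

lemma regularly_decaying_std_normal_cdf_neg:
  assumes "\<kappa> < 0"
  shows "regularly_decaying (\<lambda>z. std_normal_cdf (- \<kappa> * z)) 0 1 1"
proof (rule regularly_decayingI)
  have "filterlim (\<lambda>z. - \<kappa> * z) at_top at_top"
    using assms by real_asymp
  from filterlim_compose[OF tendsto_std_normal_cdf_at_top this]
  show "((\<lambda>z. z ^ 0 * std_normal_cdf (- \<kappa> * z)) \<longlongrightarrow> 1) at_top"
    by simp
qed (auto simp: std_normal_cdf_nonneg std_normal_cdf_le_1)

lemma nn_integral_normal_density: "0 < \<sigma> \<Longrightarrow> (\<integral>\<^sup>+x. ennreal (normal_density \<mu> \<sigma> x) \<partial>lborel) = 1"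
  by (subst nn_integral_eq_integral) auto

text \<open>
  Writing the distribution function as an integral over the fixed half line \<open>w \<le> 0\<close> moves its
  argument into the mean of the integrand, which makes Fubini applicable below.
\<close>
lemma nn_integral_normal_density_below_0:
  assumes "0 < \<tau>"
  shows "(\<integral>\<^sup>+w. ennreal (normal_density (- d) \<tau> w) * indicator {..0} w \<partial>lborel)
    = ennreal (std_normal_cdf (d / \<tau>))"
proof -
  have "(\<integral>\<^sup>+w. ennreal (normal_density (- d) \<tau> w) * indicator {..0} w \<partial>lborel)
     = (\<integral>\<^sup>+v. ennreal \<bar>\<tau>\<bar> * (ennreal (normal_density (- d) \<tau> (- d + \<tau> * v)) * indicator {..0} (- d + \<tau> * v)) \<partial>lborel)"
    using assms by (subst nn_integral_real_affine[of _ \<tau> "- d"]) (auto simp: nn_integral_cmult)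
  also have "\<dots> = (\<integral>\<^sup>+v. ennreal (std_normal_density v) * indicator {..d / \<tau>} v \<partial>lborel)"
  proof (intro nn_integral_cong)
    fix v
    have "\<bar>\<tau>\<bar> * normal_density (- d) \<tau> (- d + \<tau> * v) = std_normal_density v"
      using assms by (simp add: normal_density_def power_mult_distrib real_sqrt_mult field_simps)
    moreover have "indicator {..0} (- d + \<tau> * v) = (indicator {..d / \<tau>} v :: ennreal)"
      using assms by (auto simp: indicator_def field_simps)
    ultimately show "ennreal \<bar>\<tau>\<bar> * (ennreal (normal_density (- d) \<tau> (- d + \<tau> * v)) * indicator {..0} (- d + \<tau> * v))
       = ennreal (std_normal_density v) * indicator {..d / \<tau>} v"
      by (simp add: mult.assoc[symmetric] ennreal_mult'[symmetric])
  qed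
  also have "\<dots> = emeasure std_normal_distribution {..d / \<tau>}"
    by (simp add: emeasure_density)
  also have "\<dots> = ennreal (std_normal_cdf (d / \<tau>))"
    unfolding cdf_def2
    by (intro finite_measure.emeasure_eq_measure prob_space.finite_measure
          prob_space_normal_density) simp
  finally show ?thesis .
qed

text \<open>
  Completing the square in \<open>y\<close>: the joint density of a normal variable and a noisy affine
  observation of it, factored into the law of the observation and the conditional law given it.
\<close>
lemma normal_density_mult_affine:
  fixes \<mu> \<sigma> a b y w :: real
  defines "\<tau> \<equiv> sqrt (1 + b\<^sup>2 * \<sigma>\<^sup>2)"
  assumes "0 < \<sigma>"
  shows "normal_density \<mu> \<sigma> y * normal_density (- (a + b * y)) 1 w
    = normal_density (- (a + b * \<mu>)) \<tau> w
        * normal_density (\<mu> - b * \<sigma>\<^sup>2 * (w + a + b * \<mu>) / \<tau>\<^sup>2) (\<sigma> / \<tau>) y"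
proof -
  have pos: "0 < 1 + b\<^sup>2 * \<sigma>\<^sup>2" by (simp add: add_pos_nonneg)
  then have \<tau>: "0 < \<tau>" "\<tau>\<^sup>2 = 1 + b\<^sup>2 * \<sigma>\<^sup>2" by (auto simp: \<tau>_def)
  define e v where "e = y - \<mu>" and "v = w + a + b * \<mu>"
  have arg: "w - - (a + b * y) = v + b * e" "w - - (a + b * \<mu>) = v"
      "y - (\<mu> - b * \<sigma>\<^sup>2 * (w + a + b * \<mu>) / \<tau>\<^sup>2) = e + b * \<sigma>\<^sup>2 * v / \<tau>\<^sup>2"
    by (simp_all add: e_def v_def algebra_simps)
  have "e + b * \<sigma>\<^sup>2 * v / \<tau>\<^sup>2 = (\<tau>\<^sup>2 * e + b * \<sigma>\<^sup>2 * v) / \<tau>\<^sup>2"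
    using \<tau>(1) by (simp add: add_divide_distrib)
  then have "(e + b * \<sigma>\<^sup>2 * v / \<tau>\<^sup>2)\<^sup>2 / (\<sigma> / \<tau>)\<^sup>2 = (\<tau>\<^sup>2 * e + b * \<sigma>\<^sup>2 * v)\<^sup>2 / (\<sigma>\<^sup>2 * \<tau>\<^sup>2)"
    using \<tau>(1) by (simp only: power_divide) (simp add: power2_eq_square mult_ac)
  moreover have "e\<^sup>2 / \<sigma>\<^sup>2 + (v + b * e)\<^sup>2 = v\<^sup>2 / \<tau>\<^sup>2 + (\<tau>\<^sup>2 * e + b * \<sigma>\<^sup>2 * v)\<^sup>2 / (\<sigma>\<^sup>2 * \<tau>\<^sup>2)"
  proof -
    have "e\<^sup>2 * \<tau>\<^sup>2 + (v + b * e)\<^sup>2 * (\<sigma>\<^sup>2 * \<tau>\<^sup>2) = v\<^sup>2 * \<sigma>\<^sup>2 + (\<tau>\<^sup>2 * e + b * \<sigma>\<^sup>2 * v)\<^sup>2"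
      unfolding \<tau>(2) by (simp add: power2_eq_square algebra_simps)
    moreover have "e\<^sup>2 / \<sigma>\<^sup>2 + (v + b * e)\<^sup>2 = (e\<^sup>2 * \<tau>\<^sup>2 + (v + b * e)\<^sup>2 * (\<sigma>\<^sup>2 * \<tau>\<^sup>2)) / (\<sigma>\<^sup>2 * \<tau>\<^sup>2)"
        "v\<^sup>2 / \<tau>\<^sup>2 = v\<^sup>2 * \<sigma>\<^sup>2 / (\<sigma>\<^sup>2 * \<tau>\<^sup>2)"
      using assms \<tau>(1) by (simp_all add: add_divide_distrib)
    ultimately show ?thesis
      by (simp add: add_divide_distrib)
  qed
  ultimately have quad: "e\<^sup>2 / \<sigma>\<^sup>2 + (v + b * e)\<^sup>2 = v\<^sup>2 / \<tau>\<^sup>2 + (e + b * \<sigma>\<^sup>2 * v / \<tau>\<^sup>2)\<^sup>2 / (\<sigma> / \<tau>)\<^sup>2"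
    by simp
  have "exp (- e\<^sup>2 / (2 * \<sigma>\<^sup>2)) * exp (- (v + b * e)\<^sup>2 / (2 * 1\<^sup>2))
      = exp (- (e\<^sup>2 / \<sigma>\<^sup>2 + (v + b * e)\<^sup>2) / 2)"
    by (simp add: add_divide_distrib flip: exp_add)
  also have "\<dots> = exp (- v\<^sup>2 / (2 * \<tau>\<^sup>2)) * exp (- (e + b * \<sigma>\<^sup>2 * v / \<tau>\<^sup>2)\<^sup>2 / (2 * (\<sigma> / \<tau>)\<^sup>2))"
    unfolding quad by (simp add: add_divide_distrib flip: exp_add)
  finally have ex: "exp (- e\<^sup>2 / (2 * \<sigma>\<^sup>2)) * exp (- (v + b * e)\<^sup>2 / (2 * 1\<^sup>2)) = \<dots>" .
  have const: "1 / sqrt (2 * pi * \<sigma>\<^sup>2) * (1 / sqrt (2 * pi * 1\<^sup>2))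
      = 1 / sqrt (2 * pi * \<tau>\<^sup>2) * (1 / sqrt (2 * pi * (\<sigma> / \<tau>)\<^sup>2))"
    using \<tau>(1) by (simp add: real_sqrt_mult real_sqrt_divide power_divide)
  have reorder: "c1 * x1 * (c2 * x2) = c3 * x3 * (c4 * x4)"
    if "c1 * c2 = c3 * c4" "x1 * x2 = x3 * x4" for c1 c2 c3 c4 x1 x2 x3 x4 :: real
  proof -
    have "c1 * x1 * (c2 * x2) = (c1 * c2) * (x1 * x2)" by (simp only: mult_ac)
    also have "\<dots> = c3 * x3 * (c4 * x4)" unfolding that by (simp only: mult_ac)
    finally show ?thesis .
  qed
  show ?thesis
    unfolding normal_density_def arg e_def[symmetric] by (rule reorder[OF const ex])
qed

text \<open>
  If \<open>Y\<close> is normal with mean \<open>\<mu>\<close> and deviation \<open>\<sigma>\<close> and \<open>Z\<close> is an independent standard normal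
  variable, both sides are \<open>P(Z \<le> a + b Y)\<close>: the variable \<open>Z - b Y\<close> is normal with variance
  \<open>1 + b\<^sup>2 \<sigma>\<^sup>2\<close>.
\<close>
lemma nn_integral_normal_density_std_normal_cdf:
  assumes "0 < \<sigma>"
  shows "(\<integral>\<^sup>+y. ennreal (normal_density \<mu> \<sigma> y * std_normal_cdf (a + b * y)) \<partial>lborel)
    = ennreal (std_normal_cdf ((a + b * \<mu>) / sqrt (1 + b\<^sup>2 * \<sigma>\<^sup>2)))"
proof -
  define \<tau> where "\<tau> = sqrt (1 + b\<^sup>2 * \<sigma>\<^sup>2)"
  have \<tau>: "0 < \<tau>" by (simp add: \<tau>_def add_pos_nonneg)
  let ?n = "\<lambda>y w. ennreal (normal_density \<mu> \<sigma> y * normal_density (- (a + b * y)) 1 w) * indicator {..0} w"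
  have "(\<integral>\<^sup>+y. ennreal (normal_density \<mu> \<sigma> y * std_normal_cdf (a + b * y)) \<partial>lborel)
     = (\<integral>\<^sup>+y. \<integral>\<^sup>+w. ?n y w \<partial>lborel \<partial>lborel)"
  proof (intro nn_integral_cong)
    fix y
    have "ennreal (std_normal_cdf (a + b * y)) =
        (\<integral>\<^sup>+w. ennreal (normal_density (- (a + b * y)) 1 w) * indicator {..0} w \<partial>lborel)"
      using nn_integral_normal_density_below_0[of 1 "a + b * y"] by simp
    then have "ennreal (normal_density \<mu> \<sigma> y * std_normal_cdf (a + b * y)) = ennreal (normal_density \<mu> \<sigma> y) *
        (\<integral>\<^sup>+w. ennreal (normal_density (- (a + b * y)) 1 w) * indicator {..0} w \<partial>lborel)"
      by (simp add: ennreal_mult' std_normal_cdf_nonneg)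
    then show "ennreal (normal_density \<mu> \<sigma> y * std_normal_cdf (a + b * y)) = (\<integral>\<^sup>+w. ?n y w \<partial>lborel)"
      by (simp add: nn_integral_cmult ennreal_mult' mult.assoc)
  qed
  also have "\<dots> = (\<integral>\<^sup>+w. \<integral>\<^sup>+y. ?n y w \<partial>lborel \<partial>lborel)"
    by (rule lborel_pair.Fubini') (simp add: split_beta' normal_density_def)
  also have "\<dots> = (\<integral>\<^sup>+w. ennreal (normal_density (- (a + b * \<mu>)) \<tau> w) * indicator {..0} w \<partial>lborel)"
  proof (intro nn_integral_cong)
    fix w
    have "(\<integral>\<^sup>+y. ?n y w \<partial>lborel) = (\<integral>\<^sup>+y. ennreal (normal_density (- (a + b * \<mu>)) \<tau> w) * indicator {..0} w
        * ennreal (normal_density (\<mu> - b * \<sigma>\<^sup>2 * (w + a + b * \<mu>) / \<tau>\<^sup>2) (\<sigma> / \<tau>) y) \<partial>lborel)"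
      using normal_density_mult_affine[OF assms, of \<mu> _ a b w]
      by (intro nn_integral_cong) (simp add: \<tau>_def ennreal_mult' mult_ac)
    also have "\<dots> = ennreal (normal_density (- (a + b * \<mu>)) \<tau> w) * indicator {..0} w"
      using assms \<tau> by (subst nn_integral_cmult) (auto simp: nn_integral_normal_density)
    finally show "(\<integral>\<^sup>+y. ?n y w \<partial>lborel) = \<dots>" .
  qed
  also have "\<dots> = ennreal (std_normal_cdf ((a + b * \<mu>) / \<tau>))"
    using \<tau> by (rule nn_integral_normal_density_below_0)
  finally show ?thesis unfolding \<tau>_def .
qed

section \<open>Skew normal densities and their marginals\<close>

text \<open>
  This transports integrals over \<open>real^2\<close> to the product type, where Fubini's theorem and the
  quadrant lemma live.
\<close>
lemma lborel_vec2_eq_distr: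
  "(lborel :: (real^2) measure) = distr lborel borel (\<lambda>z. vector [fst z, snd z])"
proof (rule lborel_eqI)
  let ?v = "\<lambda>z :: real \<times> real. vector [fst z, snd z] :: real^2"
  have v[measurable]: "?v \<in> borel_measurable borel"
    by (subst borel_measurable_euclidean_space)
      (auto simp: Basis_vec_def inner_axis UNIV_2)
  fix l u :: "real^2"
  assume lu: "\<And>b. b \<in> Basis \<Longrightarrow> l \<bullet> b \<le> u \<bullet> b"
  have le: "l $ i \<le> u $ i" for i
    using lu[of "axis i 1"] by (simp add: axis_in_Basis_iff inner_axis)
  have "?v -` box l u = box (l $ 1, l $ 2) (u $ 1, u $ 2)"
    by (auto simp: mem_box_cart forall_2 box_def[of "_ :: real \<times> real"] Basis_prod_def)
  then have "emeasure (distr lborel borel ?v) (box l u)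
      = emeasure lborel (box (l $ 1, l $ 2) (u $ 1, u $ 2))"
    by (simp add: emeasure_distr)
  also have "\<dots> = (u $ 1 - l $ 1) * (u $ 2 - l $ 2)"
    using le by (subst emeasure_lborel_box) (auto simp: Basis_prod_def prod.union_disjoint)
  also have "\<dots> = (\<Prod>b\<in>Basis. (u - l) \<bullet> b)"
    by (simp add: Basis_vec_def prod.reindex inj_on_def axis_eq_axis inner_axis UNIV_2 mult.commute)
  finally show "emeasure (distr lborel borel ?v) (box l u) = (\<Prod>b\<in>Basis. (u - l) \<bullet> b)" .
qed simp

lemma matrix_inv_eqI:
  fixes A B :: "'a::field^'n^'n"
  assumes "A ** B = mat 1"
  shows "matrix_inv A = B"
proof -
  have "B ** A = mat 1"
    using assms by (simp add: matrix_left_right_inverse)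
  moreover have "A' = B" if "A' ** A = mat 1" for A'
  proof -
    have "A' = A' ** (A ** B)"
      using assms by simp
    also have "\<dots> = B"
      unfolding matrix_mul_assoc that by simp
    finally show ?thesis .
  qed
  ultimately show ?thesis
    unfolding matrix_inv_def using assms by (intro some_equality conjI) blast+
qed

lemma bivariate_normal_density_eq:
  fixes \<rho> x y :: real
  assumes "-1 < \<rho>" "\<rho> < 1"
  shows "bivariate_normal_density (vector [vector [1, \<rho>], vector [\<rho>, 1]]) (vector [x, y])
    = exp (- (x\<^sup>2 - 2 * \<rho> * x * y + y\<^sup>2) / (2 * (1 - \<rho>\<^sup>2))) / (2 * pi * sqrt (1 - \<rho>\<^sup>2))"
proof -
  let ?R = "vector [vector [1, \<rho>], vector [\<rho>, 1]] :: real^2^2"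
  let ?S = "vector [vector [1 / (1 - \<rho>\<^sup>2), - \<rho> / (1 - \<rho>\<^sup>2)], vector [- \<rho> / (1 - \<rho>\<^sup>2), 1 / (1 - \<rho>\<^sup>2)]] :: real^2^2"
  have D: "0 < 1 - \<rho>\<^sup>2"
    using assms by (simp add: abs_square_less_1 abs_less_iff)
  have "?R ** ?S = mat 1"
    using D by (simp add: vec_eq_iff forall_2 matrix_matrix_mult_def sum_2 mat_def)
      (simp add: field_simps power2_eq_square)
  then have inv: "matrix_inv ?R = ?S"
    by (rule matrix_inv_eqI)
  have "vector [x, y] \<bullet> (?S *v vector [x, y]) = (x\<^sup>2 - 2 * \<rho> * x * y + y\<^sup>2) / (1 - \<rho>\<^sup>2)"
    by (simp add: inner_vec_def matrix_vector_mult_def sum_2 add_divide_distrib diff_divide_distrib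
         power2_eq_square algebra_simps)
  moreover have "det ?R = 1 - \<rho>\<^sup>2"
    by (simp add: det_2 power2_eq_square)
  ultimately show ?thesis
    unfolding bivariate_normal_density_def inv by (simp only: divide_divide_eq_left mult.commute minus_divide_left)
qed

definition equicorrelation_matrix :: "real \<Rightarrow> real^2^2" where
  "equicorrelation_matrix \<rho> = vector [vector [1, \<rho>], vector [\<rho>, 1]]"

lemma skew_normal_density_eq:
  fixes \<theta> \<rho> x y :: real
  assumes "-1 < \<rho>" "\<rho> < 1"
  shows "skew_normal_density (vector [\<theta>, \<theta>]) (equicorrelation_matrix \<rho>) (vector [x, y])
    = exp (- (x\<^sup>2 - 2 * \<rho> * x * y + y\<^sup>2) / (2 * (1 - \<rho>\<^sup>2))) / (pi * sqrt (1 - \<rho>\<^sup>2))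
        * std_normal_cdf (\<theta> * (x + y))"
  unfolding skew_normal_density_def equicorrelation_matrix_def bivariate_normal_density_eq[OF assms]
  by (simp add: inner_vec_def sum_2 algebra_simps)

definition univariate_skew_normal_density :: "real \<Rightarrow> real \<Rightarrow> real" where
  "univariate_skew_normal_density \<delta> x = 2 * std_normal_density x * std_normal_cdf (\<delta> * x)"

text \<open>
  Given the first coordinate \<open>x\<close>, the second is normal with mean \<open>\<rho> x\<close> and variance
  \<open>1 - \<rho>\<^sup>2\<close> before skewing; in this form \<open>y\<close> can be integrated out.
\<close>
lemma skew_normal_density_eq_conditional:
  fixes \<theta> \<rho> x y :: real
  assumes "-1 < \<rho>" "\<rho> < 1"
  shows "skew_normal_density (vector [\<theta>, \<theta>]) (equicorrelation_matrix \<rho>) (vector [x, y])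
    = 2 * std_normal_density x
        * (normal_density (\<rho> * x) (sqrt (1 - \<rho>\<^sup>2)) y * std_normal_cdf (\<theta> * x + \<theta> * y))"
proof -
  have D: "0 < 1 - \<rho>\<^sup>2"
    using assms by (simp add: abs_square_less_1 abs_less_iff)
  have "- x\<^sup>2 / 2 + - (y - \<rho> * x)\<^sup>2 / (2 * (1 - \<rho>\<^sup>2)) = - (x\<^sup>2 - 2 * \<rho> * x * y + y\<^sup>2) / (2 * (1 - \<rho>\<^sup>2))"
    using D by (simp add: field_simps power2_eq_square)
  then have ex: "exp (- x\<^sup>2 / 2) * exp (- (y - \<rho> * x)\<^sup>2 / (2 * (sqrt (1 - \<rho>\<^sup>2))\<^sup>2))
      = exp (- (x\<^sup>2 - 2 * \<rho> * x * y + y\<^sup>2) / (2 * (1 - \<rho>\<^sup>2)))"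
    using D by (simp only: exp_add[symmetric] real_sqrt_pow2 less_imp_le)
  have const: "2 * (1 / sqrt (2 * pi)) * (1 / sqrt (2 * pi * (sqrt (1 - \<rho>\<^sup>2))\<^sup>2)) = 1 / (pi * sqrt (1 - \<rho>\<^sup>2))"
  proof -
    have "2 * (1 / a) * (1 / (a * s)) = 2 / (a\<^sup>2 * s)" for a s :: real
      by (simp add: power2_eq_square)
    from this[of "sqrt (2 * pi)" "sqrt (1 - \<rho>\<^sup>2)"] show ?thesis
      using D by (simp add: real_sqrt_mult[of "2 * pi"] del: real_sqrt_mult)
  qed
  have "2 * std_normal_density x * normal_density (\<rho> * x) (sqrt (1 - \<rho>\<^sup>2)) y
      = (2 * (1 / sqrt (2 * pi)) * (1 / sqrt (2 * pi * (sqrt (1 - \<rho>\<^sup>2))\<^sup>2)))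
        * (exp (- x\<^sup>2 / 2) * exp (- (y - \<rho> * x)\<^sup>2 / (2 * (sqrt (1 - \<rho>\<^sup>2))\<^sup>2)))"
    unfolding std_normal_density_def unfolding normal_density_def by (simp only: mult_ac)
  also have "\<dots> = exp (- (x\<^sup>2 - 2 * \<rho> * x * y + y\<^sup>2) / (2 * (1 - \<rho>\<^sup>2))) / (pi * sqrt (1 - \<rho>\<^sup>2))"
    unfolding const ex by simp
  finally have "exp (- (x\<^sup>2 - 2 * \<rho> * x * y + y\<^sup>2) / (2 * (1 - \<rho>\<^sup>2))) / (pi * sqrt (1 - \<rho>\<^sup>2))
      = 2 * std_normal_density x * normal_density (\<rho> * x) (sqrt (1 - \<rho>\<^sup>2)) y" ..
  then show ?thesis
    by (simp only: skew_normal_density_eq[OF assms] mult.assoc distrib_left)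
qed

lemma nn_integral_skew_normal_density:
  fixes \<theta> \<rho> x :: real
  assumes "-1 < \<rho>" "\<rho> < 1"
  shows "(\<integral>\<^sup>+y. ennreal (skew_normal_density (vector [\<theta>, \<theta>]) (equicorrelation_matrix \<rho>) (vector [x, y])) \<partial>lborel)
    = ennreal (univariate_skew_normal_density (\<theta> * (1 + \<rho>) / sqrt (1 + \<theta>\<^sup>2 * (1 - \<rho>\<^sup>2))) x)"
proof -
  have D: "0 < 1 - \<rho>\<^sup>2"
    using assms by (simp add: abs_square_less_1 abs_less_iff)
  have "(\<integral>\<^sup>+y. ennreal (skew_normal_density (vector [\<theta>, \<theta>]) (equicorrelation_matrix \<rho>) (vector [x, y])) \<partial>lborel)
     = ennreal (2 * std_normal_density x) *
       (\<integral>\<^sup>+y. ennreal (normal_density (\<rho> * x) (sqrt (1 - \<rho>\<^sup>2)) y * std_normal_cdf (\<theta> * x + \<theta> * y)) \<partial>lborel)"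
    unfolding skew_normal_density_eq_conditional[OF assms]
    by (subst nn_integral_cmult[symmetric])
       (auto simp: ennreal_mult[symmetric] std_normal_cdf_nonneg intro!: nn_integral_cong)
  also have "\<dots> = ennreal (2 * std_normal_density x) *
      ennreal (std_normal_cdf ((\<theta> * x + \<theta> * (\<rho> * x)) / sqrt (1 + \<theta>\<^sup>2 * (sqrt (1 - \<rho>\<^sup>2))\<^sup>2)))"
    using D by (subst nn_integral_normal_density_std_normal_cdf) auto
  also have "(\<theta> * x + \<theta> * (\<rho> * x)) / sqrt (1 + \<theta>\<^sup>2 * (sqrt (1 - \<rho>\<^sup>2))\<^sup>2)
      = \<theta> * (1 + \<rho>) / sqrt (1 + \<theta>\<^sup>2 * (1 - \<rho>\<^sup>2)) * x"
    using D by (simp add: algebra_simps)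
  finally show ?thesis
    by (simp add: univariate_skew_normal_density_def ennreal_mult std_normal_cdf_nonneg)
qed

lemma skew_normal_distributed_emeasure:
  fixes A :: "(real \<times> real) set"
  assumes X: "skew_normal_distributed M X \<theta> R" and A [measurable]: "A \<in> sets borel"
  shows "emeasure M {\<omega> \<in> space M. (X \<omega> $ 1, X \<omega> $ 2) \<in> A}
    = (\<integral>\<^sup>+z. ennreal (skew_normal_density \<theta> R (vector [fst z, snd z])) * indicator A z \<partial>lborel)"
proof -
  have D: "distributed M lborel X (\<lambda>x. ennreal (skew_normal_density \<theta> R x))"
    using X by (simp add: skew_normal_distributed_def)
  have [measurable]: "(\<lambda>x. ennreal (skew_normal_density \<theta> R x)) \<in> borel_measurable borel"
    using distributed_borel_measurable[OF D] by simp
  have [measurable]: "(\<lambda>x :: real^2. (x $ 1, x $ 2)) \<in> borel_measurable borel"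
    by (intro borel_measurable_continuous_onI continuous_intros)
  have [measurable]: "(\<lambda>z :: real \<times> real. vector [fst z, snd z] :: real^2) \<in> borel_measurable borel"
    by (subst borel_measurable_euclidean_space) (auto simp: Basis_vec_def inner_axis UNIV_2)
  let ?A = "(\<lambda>x :: real^2. (x $ 1, x $ 2)) -` A"
  have A': "?A \<in> sets borel"
    using measurable_sets_borel[of "\<lambda>x :: real^2. (x $ 1, x $ 2)" borel A] by simp
  have "{\<omega> \<in> space M. (X \<omega> $ 1, X \<omega> $ 2) \<in> A} = X -` ?A \<inter> space M"
    by auto
  then have "emeasure M {\<omega> \<in> space M. (X \<omega> $ 1, X \<omega> $ 2) \<in> A}
      = (\<integral>\<^sup>+x. ennreal (skew_normal_density \<theta> R x) * indicator ?A x \<partial>lborel)"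
    using A' by (simp add: distributed_emeasure[OF D])
  also have "\<dots> = (\<integral>\<^sup>+z. ennreal (skew_normal_density \<theta> R (vector [fst z, snd z]))
      * indicator ?A (vector [fst z, snd z]) \<partial>lborel)"
    by (subst lborel_vec2_eq_distr, subst nn_integral_distr) (use A' in auto)
  also have "\<dots> = (\<integral>\<^sup>+z. ennreal (skew_normal_density \<theta> R (vector [fst z, snd z])) * indicator A z \<partial>lborel)"
    by (intro nn_integral_cong) (simp add: indicator_def)
  finally show ?thesis .
qed

text \<open>
  For the first coordinate Fubini integrates out \<open>y\<close>; the density is symmetric because both
  entries of the skewness vector agree, so the second coordinate has the same law.
\<close>
lemma skew_normal_marginal_distributed:
  fixes \<theta> \<rho> :: real
  assumes \<rho>: "-1 < \<rho>" "\<rho> < 1"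
    and X: "skew_normal_distributed M X (vector [\<theta>, \<theta>]) (equicorrelation_matrix \<rho>)"
  shows "distributed M lborel (\<lambda>\<omega>. X \<omega> $ i)
    (\<lambda>x. ennreal (univariate_skew_normal_density (\<theta> * (1 + \<rho>) / sqrt (1 + \<theta>\<^sup>2 * (1 - \<rho>\<^sup>2))) x))"
  unfolding distributed_def
proof (intro conjI measure_eqI)
  let ?f = "\<lambda>x y. ennreal (skew_normal_density (vector [\<theta>, \<theta>]) (equicorrelation_matrix \<rho>) (vector [x, y]))"
  let ?h = "univariate_skew_normal_density (\<theta> * (1 + \<rho>) / sqrt (1 + \<theta>\<^sup>2 * (1 - \<rho>\<^sup>2)))"
  have h [measurable]: "(\<lambda>x. ennreal (?h x)) \<in> borel_measurable borel"
    unfolding univariate_skew_normal_density_def by measurable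
  then show "(\<lambda>x. ennreal (?h x)) \<in> borel_measurable lborel"
    by simp
  have f [measurable]: "(\<lambda>z. ?f (fst z) (snd z)) \<in> borel_measurable (borel \<Otimes>\<^sub>M borel)"
    unfolding skew_normal_density_eq[OF \<rho>] by measurable
  have f_section [measurable]: "?f x \<in> borel_measurable borel" for x
    unfolding skew_normal_density_eq[OF \<rho>] by measurable
  have f_commute: "?f x y = ?f y x" for x y
    unfolding skew_normal_density_eq[OF \<rho>] by (simp add: algebra_simps)
  have X_meas: "X \<in> measurable M lborel"
    using X by (auto simp: skew_normal_distributed_def distributed_def)
  then have Xi: "(\<lambda>\<omega>. X \<omega> $ i) \<in> borel_measurable M"
    using measurable_compose[of X M borel "\<lambda>x. x $ i" borel]
    by (simp add: borel_measurable_continuous_onI continuous_on_component continuous_on_id)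
  then show "(\<lambda>\<omega>. X \<omega> $ i) \<in> measurable M lborel"
    by simp
  fix S assume "S \<in> sets (distr M lborel (\<lambda>\<omega>. X \<omega> $ i))"
  then have S [measurable]: "S \<in> sets borel" by simp
  have "emeasure M {\<omega> \<in> space M. X \<omega> $ i \<in> S} = (\<integral>\<^sup>+x. ennreal (?h x) * indicator S x \<partial>lborel)"
  proof (cases "i = 1")
    case True
    have "emeasure M {\<omega> \<in> space M. X \<omega> $ i \<in> S} = emeasure M {\<omega> \<in> space M. (X \<omega> $ 1, X \<omega> $ 2) \<in> S \<times> UNIV}"
      using True by simp
    also have "\<dots> = (\<integral>\<^sup>+z. ?f (fst z) (snd z) * indicator (S \<times> UNIV) z \<partial>(lborel \<Otimes>\<^sub>M lborel))"
      unfolding lborel_prod by (rule skew_normal_distributed_emeasure[OF X]) (simp add: borel_Times)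
    also have "\<dots> = (\<integral>\<^sup>+x. \<integral>\<^sup>+y. ?f x y * indicator S x \<partial>lborel \<partial>lborel)"
      by (subst lborel.nn_integral_fst[symmetric]) (auto simp: indicator_times)
    also have "\<dots> = (\<integral>\<^sup>+x. ennreal (?h x) * indicator S x \<partial>lborel)"
      by (intro nn_integral_cong, subst nn_integral_multc)
         (auto simp: nn_integral_skew_normal_density[OF \<rho>])
    finally show ?thesis .
  next
    case False
    then have "i = 2" using exhaust_2[of i] by simp
    then have "emeasure M {\<omega> \<in> space M. X \<omega> $ i \<in> S} = emeasure M {\<omega> \<in> space M. (X \<omega> $ 1, X \<omega> $ 2) \<in> UNIV \<times> S}"
      by simp
    also have "\<dots> = (\<integral>\<^sup>+z. ?f (fst z) (snd z) * indicator (UNIV \<times> S) z \<partial>(lborel \<Otimes>\<^sub>M lborel))"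
      unfolding lborel_prod by (rule skew_normal_distributed_emeasure[OF X]) (simp add: borel_Times)
    also have "\<dots> = (\<integral>\<^sup>+y. \<integral>\<^sup>+x. ?f y x * indicator S y \<partial>lborel \<partial>lborel)"
      by (subst lborel_pair.nn_integral_snd[symmetric]) (auto simp: indicator_times f_commute)
    also have "\<dots> = (\<integral>\<^sup>+x. ennreal (?h x) * indicator S x \<partial>lborel)"
      by (intro nn_integral_cong, subst nn_integral_multc)
         (auto simp: nn_integral_skew_normal_density[OF \<rho>])
    finally show ?thesis .
  qed
  moreover have "emeasure (distr M lborel (\<lambda>\<omega>. X \<omega> $ i)) S = emeasure M {\<omega> \<in> space M. X \<omega> $ i \<in> S}"
    using Xi by (subst emeasure_distr) (auto intro!: arg_cong[where f = "emeasure M"])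
  ultimately show "emeasure (distr M lborel (\<lambda>\<omega>. X \<omega> $ i)) S = emeasure (density lborel (\<lambda>x. ennreal (?h x))) S"
    by (simp add: emeasure_density)
qed simp

section \<open>Substituting the quantile function\<close>

text \<open>
  As \<open>F\<close> is monotone and positive at \<open>- Z\<close>, a value \<open>u < F (- Z)\<close> can only be attained to the
  left of \<open>- Z\<close>.
\<close>
lemma filterlim_neg_quantile_at_top:
  fixes F q :: "real \<Rightarrow> real"
  assumes "mono F" and pos: "\<And>x. 0 < F x" and q: "\<forall>\<^sub>F u in at_right 0. F (q u) = u"
  shows "filterlim (\<lambda>u. - q u) at_top (at_right 0)"
  unfolding filterlim_at_top
proof
  fix Z :: real
  have "\<forall>\<^sub>F u in at_right 0. u < F (- Z)"
    using pos[of "- Z"] by (auto simp: eventually_at_right_field)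
  with q show "\<forall>\<^sub>F u in at_right 0. Z \<le> - q u"
  proof eventually_elim
    fix u assume "F (q u) = u" "u < F (- Z)"
    then have "\<not> - Z \<le> q u"
      using monoD[OF \<open>mono F\<close>, of "- Z" "q u"] by auto
    then show "Z \<le> - q u" by simp
  qed
qed

text \<open>
  Set \<open>t = tq u\<close>. The hypotheses say that \<open>v = t^m exp (B t\<^sup>2) u\<close> tends to \<open>A\<close> and
  \<open>w = t^n exp (\<gamma> B t\<^sup>2) J t\<close> tends to \<open>D\<close>. In \<open>w v powr (- \<gamma>)\<close> the exponentials cancel exactly and
  leave \<open>J t u powr (- \<gamma>) t powr (n - \<gamma> m)\<close>. Taking logarithms in the first relation gives
  \<open>t\<^sup>2 \<sim> - ln u / B\<close>, which is precise enough for a power of \<open>t\<close>.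
\<close>
lemma asymp_equiv_at_gaussian_quantile:
  fixes G J tq :: "real \<Rightarrow> real" and A B D \<gamma> :: real and m n :: nat
  assumes tq: "filterlim tq at_top (at_right 0)" "\<forall>\<^sub>F u in at_right 0. G (tq u) = u"
    and G: "((\<lambda>t. t ^ m * exp (B * t\<^sup>2) * G t) \<longlongrightarrow> A) at_top"
    and J: "((\<lambda>t. t ^ n * exp (\<gamma> * B * t\<^sup>2) * J t) \<longlongrightarrow> D) at_top"
    and "0 < A" "0 < B" "0 < D"
  shows "(\<lambda>u. J (tq u) / u) \<sim>[at_right 0]
    (\<lambda>u. D * A powr (- \<gamma>) * u powr (\<gamma> - 1) * (- ln u / B) powr ((\<gamma> * m - n) / 2))"
proof (rule asymp_equivI')
  define v where "v u = tq u ^ m * exp (B * (tq u)\<^sup>2) * u" for u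
  define w where "w u = tq u ^ n * exp (\<gamma> * B * (tq u)\<^sup>2) * J (tq u)" for u
  define e where "e = (\<gamma> * m - n) / 2"
  have u_range: "\<forall>\<^sub>F u in at_right (0::real). 0 < u \<and> u < 1"
    by (auto simp: eventually_at_right_field intro: exI[of _ 1])
  have t_pos: "\<forall>\<^sub>F u in at_right 0. 0 < tq u"
    by (rule eventually_compose_filterlim[OF eventually_gt_at_top tq(1)])
  have v_lim: "(v \<longlongrightarrow> A) (at_right 0)"
    using filterlim_compose[OF G tq(1)]
    by (rule Lim_transform_eventually) (use tq(2) in eventually_elim, simp add: v_def)
  have w_lim: "(w \<longlongrightarrow> D) (at_right 0)"
    using filterlim_compose[OF J tq(1)] unfolding w_def .
  have "((\<lambda>u. 1 + m / B * (ln (tq u) / (tq u)\<^sup>2) - ln (v u) * (1 / (B * (tq u)\<^sup>2)))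
      \<longlongrightarrow> 1 + m / B * 0 - ln A * 0) (at_right 0)"
  proof (intro tendsto_intros v_lim)
    have "((\<lambda>t::real. ln t / t\<^sup>2) \<longlongrightarrow> 0) at_top" by real_asymp
    from filterlim_compose[OF this tq(1)]
    show "((\<lambda>u. ln (tq u) / (tq u)\<^sup>2) \<longlongrightarrow> 0) (at_right 0)" .
    have "((\<lambda>t::real. 1 / (B * t\<^sup>2)) \<longlongrightarrow> 0) at_top" using \<open>0 < B\<close> by real_asymp
    from filterlim_compose[OF this tq(1)]
    show "((\<lambda>u. 1 / (B * (tq u)\<^sup>2)) \<longlongrightarrow> 0) (at_right 0)" .
  qed (use \<open>0 < A\<close> in auto)
  then have "((\<lambda>u. (- ln u / B) / (tq u)\<^sup>2) \<longlongrightarrow> 1 + m / B * 0 - ln A * 0) (at_right 0)"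
  proof (rule Lim_transform_eventually)
    show "\<forall>\<^sub>F u in at_right 0. 1 + m / B * (ln (tq u) / (tq u)\<^sup>2) - ln (v u) * (1 / (B * (tq u)\<^sup>2))
        = (- ln u / B) / (tq u)\<^sup>2"
      using u_range t_pos
    proof eventually_elim
      fix u assume *: "0 < u \<and> u < 1" "0 < tq u"
      then have "ln (v u) = m * ln (tq u) + B * (tq u)\<^sup>2 + ln u"
        by (simp add: v_def ln_mult ln_realpow)
      then show "1 + m / B * (ln (tq u) / (tq u)\<^sup>2) - ln (v u) * (1 / (B * (tq u)\<^sup>2))
        = (- ln u / B) / (tq u)\<^sup>2"
        using * \<open>0 < B\<close> by (simp add: field_simps)
    qed
  qed
  \<comment> \<open>The quotient claimed to tend to 1 is a product of powers of \<open>w / D\<close>, \<open>v / A\<close> and this ratio.\<close>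
  then have L_lim: "((\<lambda>u. (- ln u / B) / (tq u)\<^sup>2) \<longlongrightarrow> 1) (at_right 0)"
    by simp
  have "((\<lambda>u. w u / D * (v u / A) powr (- \<gamma>) * ((- ln u / B) / (tq u)\<^sup>2) powr (- e))
      \<longlongrightarrow> D / D * (A / A) powr (- \<gamma>) * 1 powr (- e)) (at_right 0)"
    using \<open>0 < A\<close> \<open>0 < D\<close> by (intro tendsto_intros v_lim w_lim L_lim) auto
  then have "((\<lambda>u. w u / D * (v u / A) powr (- \<gamma>) * ((- ln u / B) / (tq u)\<^sup>2) powr (- e)) \<longlongrightarrow> 1) (at_right 0)"
    using \<open>0 < A\<close> \<open>0 < D\<close> by simp
  then show "((\<lambda>u. J (tq u) / u / (D * A powr (- \<gamma>) * u powr (\<gamma> - 1) * (- ln u / B) powr ((\<gamma> * m - n) / 2)))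
      \<longlongrightarrow> 1) (at_right 0)"
  proof (rule Lim_transform_eventually)
    show "\<forall>\<^sub>F u in at_right 0. w u / D * (v u / A) powr (- \<gamma>) * ((- ln u / B) / (tq u)\<^sup>2) powr (- e)
      = J (tq u) / u / (D * A powr (- \<gamma>) * u powr (\<gamma> - 1) * (- ln u / B) powr ((\<gamma> * m - n) / 2))"
      using u_range t_pos
    proof eventually_elim
      fix u assume u: "0 < u \<and> u < 1" and t: "0 < tq u"
      define t where "t = tq u"
      define L where "L = - ln u / B"
      have "0 < L" using u \<open>0 < B\<close> by (simp add: L_def divide_less_0_iff)
      have "0 < t" using t by (simp add: t_def)
      have "v u = t powr m * exp (B * t\<^sup>2) * u"
        using \<open>0 < t\<close> by (simp add: v_def powr_realpow t_def)
      then have v: "(v u / A) powr (- \<gamma>) = t powr (- \<gamma> * m) * exp (- \<gamma> * B * t\<^sup>2) * u powr (- \<gamma>) / A powr (- \<gamma>)"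
        using u \<open>0 < t\<close> \<open>0 < A\<close>
        by (simp add: powr_divide powr_mult powr_powr exp_powr_real mult_ac)
      have "(t\<^sup>2) powr (- e) = t powr (2 * - e)"
        using \<open>0 < t\<close> by (simp add: powr_powr flip: powr_numeral)
      also have "2 * - e = - (\<gamma> * m - n)"
        by (simp add: e_def field_simps)
      finally have L: "(L / t\<^sup>2) powr (- e) = L powr (- e) * t powr (\<gamma> * m - n)"
        using \<open>0 < t\<close> \<open>0 < L\<close> by (simp only: powr_divide powr_minus_divide) simp
      have "t powr n * exp (\<gamma> * B * t\<^sup>2) * J t / D *
          (t powr (- \<gamma> * m) * exp (- \<gamma> * B * t\<^sup>2) * u powr (- \<gamma>) / A powr (- \<gamma>))
          * (L powr (- e) * t powr (\<gamma> * m - n))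
         = (t powr n * t powr (- \<gamma> * m) * t powr (\<gamma> * m - n)) * (exp (\<gamma> * B * t\<^sup>2) * exp (- \<gamma> * B * t\<^sup>2)) *
           (J t / D * u powr (- \<gamma>) / A powr (- \<gamma>) * L powr (- e))"
        by (simp add: mult_ac)
      also have "t powr n * t powr (- \<gamma> * m) * t powr (\<gamma> * m - n) = 1"
        using \<open>0 < t\<close> by (simp flip: powr_add)
      also have "exp (\<gamma> * B * t\<^sup>2) * exp (- \<gamma> * B * t\<^sup>2) = 1"
        by (simp flip: exp_add)
      also have "1 * 1 * (J t / D * u powr (- \<gamma>) / A powr (- \<gamma>) * L powr (- e))
          = J t / u / (D * A powr (- \<gamma>) * u powr (\<gamma> - 1) * L powr e)"
        using u by (simp add: powr_minus powr_diff field_simps)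
      finally show "w u / D * (v u / A) powr (- \<gamma>) * ((- ln u / B) / (tq u)\<^sup>2) powr (- e)
        = J (tq u) / u / (D * A powr (- \<gamma>) * u powr (\<gamma> - 1) * (- ln u / B) powr ((\<gamma> * m - n) / 2))"
        unfolding w_def v t_def[symmetric] L_def[symmetric] L e_def[symmetric] powr_realpow[OF \<open>0 < t\<close>, of n, symmetric] .
    qed
  qed
qed

section \<open>Tails of the skew normal law\<close>

text \<open>
  The equicorrelation matrix is diagonal in the coordinates \<open>x + y\<close> and \<open>x - y\<close>, with eigenvalues
  \<open>1 + \<rho>\<close> and \<open>1 - \<rho>\<close>.
\<close>
lemma gaussian_exponent_sum_diff:
  fixes \<rho> x y :: real
  assumes "-1 < \<rho>" "\<rho> < 1"
  shows "(x\<^sup>2 - 2 * \<rho> * x * y + y\<^sup>2) / (2 * (1 - \<rho>\<^sup>2))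
    = 1 / (4 * (1 + \<rho>)) * (x + y)\<^sup>2 + 1 / (4 * (1 - \<rho>)) * (x - y)\<^sup>2"
proof -
  have "1 - \<rho>\<^sup>2 = (1 + \<rho>) * (1 - \<rho>)"
    by (simp add: power2_eq_square algebra_simps)
  moreover have "1 + \<rho> \<noteq> 0" "1 - \<rho> \<noteq> 0" using assms by auto
  ultimately show ?thesis
    by (simp add: divide_simps) (simp add: power2_eq_square algebra_simps)
qed

lemma distributed_cdf_eq_integral:
  fixes Y :: "'a \<Rightarrow> real" and f :: "real \<Rightarrow> real"
  assumes Y: "distributed M lborel Y (\<lambda>x. ennreal (f x))" and f_nonneg: "\<And>x. 0 \<le> f x"
  shows "cdf (distr M borel Y) x = (\<integral>y. indicator {..x} y * f y \<partial>lborel)"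
proof -
  have f: "f \<in> borel_measurable borel"
    using distributed_real_measurable[OF _ Y] f_nonneg by simp
  have "distr M borel Y = density lborel (\<lambda>x. ennreal (f x))"
    using distributed_distr_eq_density[OF Y] by (simp cong: distr_cong)
  then have "measure (distr M borel Y) {..x} = enn2real (\<integral>\<^sup>+y. ennreal (indicator {..x} y * f y) \<partial>lborel)"
    using f by (auto simp: measure_def emeasure_density indicator_def
        intro!: arg_cong[where f = enn2real] nn_integral_cong)
  then show ?thesis
    using f_nonneg f by (subst integral_eq_nn_integral) (auto simp: cdf_def2)
qed

text \<open>
  A law with a density has no atoms, so its distribution function is continuous and the
  intermediate value theorem applies. Hence \<open>inv\<close> yields a genuine preimage.
\<close>
lemma cdf_of_density_surj:
  fixes Y :: "'a \<Rightarrow> real"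
  assumes "prob_space M" and Y: "distributed M lborel Y f" and u: "0 < u" "u < 1"
  shows "\<exists>x. cdf (distr M borel Y) x = u"
proof -
  have Y_meas: "Y \<in> borel_measurable M"
    using distributed_measurable[OF Y] by simp
  have N: "real_distribution (distr M borel Y)"
    using assms(1) Y_meas by (rule prob_space.real_distribution_distr)
  note N' = real_distribution.finite_borel_measure_M[OF N]
  have "distr M borel Y = density lborel f"
    using distributed_distr_eq_density[OF Y] by (simp cong: distr_cong)
  then have "emeasure (distr M borel Y) {x} = 0" for x
    using distributed_borel_measurable[OF Y] AE_lborel_singleton[of x]
    by (auto simp: emeasure_density nn_integral_0_iff_AE elim!: eventually_mono)
  then have cont: "isCont (cdf (distr M borel Y)) x" for x
    by (simp add: finite_borel_measure.isCont_cdf[OF N'] measure_def)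
  obtain a where a: "cdf (distr M borel Y) a < u"
    using order_tendstoD(2)[OF finite_borel_measure.cdf_lim_at_bot[OF N'] u(1)] by (auto simp: eventually_at_bot_linorder)
  obtain b where b: "u < cdf (distr M borel Y) b"
    using order_tendstoD(1)[OF real_distribution.cdf_lim_at_top_prob[OF N] u(2)] by (auto simp: eventually_at_top_linorder)
  have "a \<le> b"
    using a b finite_borel_measure.cdf_nondecreasing[OF N', of b a] by linarith
  then show ?thesis
    using IVT[of "cdf (distr M borel Y)" a u b] a b cont by auto
qed

lemma univariate_skew_normal_density_nonneg: "0 \<le> univariate_skew_normal_density \<delta> x"
  by (simp add: univariate_skew_normal_density_def std_normal_cdf_nonneg)

text \<open>
  The hypothesis on the skewing factor covers both signs of \<open>\<delta>\<close>: \<open>\<kappa> = \<delta>\<^sup>2\<close> when it decays in the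
  lower tail and \<open>\<kappa> = 0\<close> when it tends to 1 there.
\<close>
lemma skew_normal_tail_limit:
  assumes rd: "regularly_decaying r k C c"
    and Y: "distributed M lborel Y (\<lambda>x. ennreal (univariate_skew_normal_density \<delta> x))"
    and factor: "\<And>s. std_normal_cdf (\<delta> * s) = exp (- (\<kappa> * s\<^sup>2 / 2)) * r (- s)" and "0 \<le> \<kappa>"
  shows "((\<lambda>t. t ^ (k + 1) * exp ((1 + \<kappa>) / 2 * t\<^sup>2) * cdf (distr M borel Y) (- t))
    \<longlongrightarrow> 2 / sqrt (2 * pi) * (c / (1 + \<kappa>))) at_top"
proof -
  note [measurable] = regularly_decaying_measurable[OF rd]
  have dens: "univariate_skew_normal_density \<delta> x
      = 2 / sqrt (2 * pi) * (exp (- ((1 + \<kappa>) / 2 * x\<^sup>2)) * r (- x))" for x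
  proof -
    have "- x\<^sup>2 / 2 + - (\<kappa> * x\<^sup>2 / 2) = - ((1 + \<kappa>) / 2 * x\<^sup>2)"
      by (simp add: field_simps)
    then have "exp (- x\<^sup>2 / 2) * exp (- (\<kappa> * x\<^sup>2 / 2)) = exp (- ((1 + \<kappa>) / 2 * x\<^sup>2))"
      by (simp only: exp_add[symmetric])
    then show ?thesis
      unfolding univariate_skew_normal_density_def factor std_normal_density_def[of x]
      by (simp add: mult.assoc[symmetric])
  qed
  have "cdf (distr M borel Y) (- t) = 2 / sqrt (2 * pi) *
      (\<integral>x. indicator {..-t} x * (exp (- ((1 + \<kappa>) / 2 * x\<^sup>2)) * r (- x)) \<partial>lborel)" for t
    unfolding distributed_cdf_eq_integral[OF Y univariate_skew_normal_density_nonneg] dens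
    by (subst integral_mult_right_zero[symmetric]) (intro Bochner_Integration.integral_cong, auto)
  then have eq: "t ^ (k + 1) * exp ((1 + \<kappa>) / 2 * t\<^sup>2) * cdf (distr M borel Y) (- t)
     = 2 / sqrt (2 * pi) * (t ^ (k + 1) * exp ((1 + \<kappa>) / 2 * t\<^sup>2) *
      (\<integral>x. indicator {..-t} x * (exp (- ((1 + \<kappa>) / 2 * x\<^sup>2)) * r (- x)) \<partial>lborel))" for t
    by (simp only: mult_ac)
  show ?thesis
    unfolding eq
  proof (rule tendsto_mult_left)
    have half_pos: "0 < (1 + \<kappa>) / 2"
      using \<open>0 \<le> \<kappa>\<close> by simp
    have "c / (2 * ((1 + \<kappa>) / 2)) = c / (1 + \<kappa>)"
      using \<open>0 \<le> \<kappa>\<close> by (simp add: field_simps)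
    then show "((\<lambda>t. t ^ (k + 1) * exp ((1 + \<kappa>) / 2 * t\<^sup>2) *
        (\<integral>x. indicator {..-t} x * (exp (- ((1 + \<kappa>) / 2 * x\<^sup>2)) * r (- x)) \<partial>lborel))
        \<longlongrightarrow> c / (1 + \<kappa>)) at_top"
      using gaussian_tail_limit[OF rd half_pos] by (simp only:)
  qed
qed

text \<open>
  The factor \<open>exp (- \<kappa> s\<^sup>2 / 2)\<close> depends on \<open>s = x + y\<close> only, so it adds \<open>2 \<kappa>\<close> to the coefficient
  \<open>1 / (1 + \<rho>)\<close> that the normal density contributes to \<open>K\<close>.
\<close>
lemma skew_normal_quadrant_limit:
  fixes \<theta> \<rho> :: real
  assumes rd: "regularly_decaying r k C c"
    and \<rho>: "-1 < \<rho>" "\<rho> < 1"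
    and X: "skew_normal_distributed M X (vector [\<theta>, \<theta>]) (equicorrelation_matrix \<rho>)"
    and factor: "\<And>s. std_normal_cdf (\<theta> * s) = exp (- (\<kappa> * s\<^sup>2 / 2)) * r (- s)" and "0 \<le> \<kappa>"
  defines "K \<equiv> 1 / (1 + \<rho>) + 2 * \<kappa>"
  shows "((\<lambda>t. t ^ (k + 2) * exp (K * t\<^sup>2) * measure M {\<omega> \<in> space M. X \<omega> $ 1 \<le> - t \<and> X \<omega> $ 2 \<le> - t})
    \<longlongrightarrow> 1 / (pi * sqrt (1 - \<rho>\<^sup>2)) * (c / (2 ^ k * K\<^sup>2))) at_top"
proof -
  note [measurable] = regularly_decaying_measurable[OF rd]
  define E where "E = 1 / (4 * (1 - \<rho>))"
  define s where "s = 1 / (pi * sqrt (1 - \<rho>\<^sup>2))"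
  have "0 < K" "0 \<le> E" using \<rho> \<open>0 \<le> \<kappa>\<close> by (auto simp: K_def E_def add_pos_nonneg)
  let ?g = "\<lambda>z :: real \<times> real. exp (- (K / 4 * (fst z + snd z)\<^sup>2 + E * (fst z - snd z)\<^sup>2)) * r (- (fst z + snd z))"
  have "\<rho>\<^sup>2 < 1" using \<rho> by (simp add: abs_square_less_1 abs_less_iff)
  then have s: "0 \<le> s" by (simp add: s_def)
  have dens: "skew_normal_density (vector [\<theta>, \<theta>]) (equicorrelation_matrix \<rho>) (vector [x, y])
      = s * ?g (x, y)" for x y
  proof -
    have "- (x\<^sup>2 - 2 * \<rho> * x * y + y\<^sup>2) / (2 * (1 - \<rho>\<^sup>2)) + - (\<kappa> * (x + y)\<^sup>2 / 2)
        = - (K / 4 * (x + y)\<^sup>2 + E * (x - y)\<^sup>2)"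
    proof -
      have "K / 4 = 1 / (4 * (1 + \<rho>)) + \<kappa> / 2"
        by (simp add: K_def add_divide_distrib)
      then show ?thesis
        unfolding minus_divide_left[symmetric] gaussian_exponent_sum_diff[OF \<rho>]
        by (simp add: E_def algebra_simps)
    qed
    then have "exp (- (x\<^sup>2 - 2 * \<rho> * x * y + y\<^sup>2) / (2 * (1 - \<rho>\<^sup>2))) * exp (- (\<kappa> * (x + y)\<^sup>2 / 2))
        = exp (- (K / 4 * (x + y)\<^sup>2 + E * (x - y)\<^sup>2))"
      by (simp only: exp_add[symmetric])
    then show ?thesis
      unfolding skew_normal_density_eq[OF \<rho>] factor s_def fst_conv snd_conv
      by (simp only: times_divide_eq_left mult_1_left flip: mult.assoc)
  qed
  have J: "measure M {\<omega> \<in> space M. X \<omega> $ 1 \<le> - t \<and> X \<omega> $ 2 \<le> - t}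
      = s * (\<integral>z. indicator ({..-t} \<times> {..-t}) z * ?g z \<partial>lborel)" for t
  proof -
    have Q [measurable]: "{..-t} \<times> {..-t} \<in> sets borel"
      by (intro borel_closed closed_Times) auto
    have "emeasure M {\<omega> \<in> space M. X \<omega> $ 1 \<le> - t \<and> X \<omega> $ 2 \<le> - t}
        = emeasure M {\<omega> \<in> space M. (X \<omega> $ 1, X \<omega> $ 2) \<in> {..-t} \<times> {..-t}}"
      by simp
    also have "\<dots> = (\<integral>\<^sup>+z. ennreal (indicator ({..-t} \<times> {..-t}) z * (s * ?g z)) \<partial>lborel)"
      unfolding skew_normal_distributed_emeasure[OF X Q] dens
      by (intro nn_integral_cong) (simp add: indicator_def)
    finally have "measure M {\<omega> \<in> space M. X \<omega> $ 1 \<le> - t \<and> X \<omega> $ 2 \<le> - t}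
        = (\<integral>z. indicator ({..-t} \<times> {..-t}) z * (s * ?g z) \<partial>lborel)"
      using s regularly_decaying_nonneg[OF rd] unfolding measure_def by (subst integral_eq_nn_integral) auto
    also have "\<dots> = (\<integral>z. s * (indicator ({..-t} \<times> {..-t}) z * ?g z) \<partial>lborel)"
      by (simp only: mult.left_commute)
    also have "\<dots> = s * (\<integral>z. indicator ({..-t} \<times> {..-t}) z * ?g z \<partial>lborel)"
      by (rule integral_mult_right_zero)
    finally show ?thesis .
  qed
  have eq: "t ^ (k + 2) * exp (K * t\<^sup>2) * measure M {\<omega> \<in> space M. X \<omega> $ 1 \<le> - t \<and> X \<omega> $ 2 \<le> - t}
     = s * (t ^ (k + 2) * exp (K * t\<^sup>2) * (\<integral>z. indicator ({..-t} \<times> {..-t}) z * ?g z \<partial>lborel))" for t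
    unfolding J by (simp only: mult_ac)
  show ?thesis
    unfolding eq s_def[symmetric]
    by (intro tendsto_mult_left gaussian_quadrant_limit[OF rd] \<open>0 < K\<close> \<open>0 \<le> E\<close>)
qed

text \<open>
  Both margins share the distribution function \<open>F\<close>, so the two thresholds coincide and the
  conditional probability is a quadrant probability divided by \<open>u\<close>. Positivity of \<open>F\<close> everywhere
  follows from its tail asymptotics and monotonicity.
\<close>
lemma lower_tail_dependence_asymp_equiv:
  fixes \<theta> \<rho> :: real and A B D \<gamma> :: real and m n :: nat
  assumes M: "prob_space M" and \<rho>: "-1 < \<rho>" "\<rho> < 1"
    and X: "skew_normal_distributed M X (vector [\<theta>, \<theta>]) (equicorrelation_matrix \<rho>)"
    and tail: "((\<lambda>t. t ^ m * exp (B * t\<^sup>2) * cdf (distr M borel (\<lambda>\<omega>. X \<omega> $ 1)) (- t)) \<longlongrightarrow> A) at_top"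
    and quadrant: "((\<lambda>t. t ^ n * exp (\<gamma> * B * t\<^sup>2)
        * measure M {\<omega> \<in> space M. X \<omega> $ 1 \<le> - t \<and> X \<omega> $ 2 \<le> - t}) \<longlongrightarrow> D) at_top"
    and pos: "0 < A" "0 < B" "0 < D"
  shows "lower_tail_dependence M X \<sim>[at_right 0]
    (\<lambda>u. D * A powr (- \<gamma>) * u powr (\<gamma> - 1) * (- ln u / B) powr ((\<gamma> * m - n) / 2))"
proof -
  note marginal = skew_normal_marginal_distributed[OF \<rho> X]
  define F where "F = cdf (distr M borel (\<lambda>\<omega>. X \<omega> $ 1))"
  have F1: "marginal_cdf M X 1 = F"
    by (simp add: marginal_cdf_def F_def)
  have F2: "marginal_cdf M X 2 = F"
    unfolding marginal_cdf_def F_def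
    by (intro ext) (simp only: distributed_cdf_eq_integral[OF marginal univariate_skew_normal_density_nonneg])
  have X_meas: "(\<lambda>\<omega>. X \<omega> $ i) \<in> borel_measurable M" for i
    using distributed_measurable[OF marginal[of i]] by simp
  have N: "real_distribution (distr M borel (\<lambda>\<omega>. X \<omega> $ 1))"
    using M X_meas by (rule prob_space.real_distribution_distr)
  have "mono F"
    unfolding F_def by (intro monoI finite_borel_measure.cdf_nondecreasing
        real_distribution.finite_borel_measure_M N)
  have u_range: "\<forall>\<^sub>F u in at_right (0::real). 0 < u \<and> u < 1"
    by (auto simp: eventually_at_right_field intro: exI[of _ 1])
  have F_inv: "F (inv F u) = u" if "0 < u" "u < 1" for u
  proof -
    have "\<exists>x. F x = u"
      using cdf_of_density_surj[OF M marginal[of 1] that] unfolding F_def .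
    then show ?thesis
      by (intro f_inv_into_f) auto
  qed
  have F_quantile: "\<forall>\<^sub>F u in at_right 0. F (inv F u) = u"
    using u_range by eventually_elim (simp add: F_inv)
  have F_pos: "0 < F x" for x
  proof -
    have "\<forall>\<^sub>F t in at_top. 0 < t ^ m * exp (B * t\<^sup>2) * F (- t)"
      using order_tendstoD(1)[OF tail pos(1)] by (simp add: F_def)
    then have "\<forall>\<^sub>F t in at_top. t \<ge> max 1 (- x) \<and> 0 < t ^ m * exp (B * t\<^sup>2) * F (- t)"
      by (intro eventually_conj eventually_ge_at_top)
    then have "\<exists>t. t \<ge> max 1 (- x) \<and> 0 < t ^ m * exp (B * t\<^sup>2) * F (- t)"
      by (rule eventually_happens'[OF trivial_limit_at_top_linorder])
    then obtain t where t: "t \<ge> max 1 (- x)" "0 < t ^ m * exp (B * t\<^sup>2) * F (- t)"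
      by (elim exE conjE)
    have "0 < t ^ m * exp (B * t\<^sup>2)"
      using t(1) by simp
    then have "0 < F (- t)"
      using t(2) by (rule zero_less_mult_pos[rotated])
    also have "F (- t) \<le> F x"
      using t by (intro monoD[OF \<open>mono F\<close>]) auto
    finally show ?thesis .
  qed
  have tq: "filterlim (\<lambda>u. - inv F u) at_top (at_right 0)"
    by (rule filterlim_neg_quantile_at_top[OF \<open>mono F\<close> F_pos F_quantile])
  define J where "J t = measure M {\<omega> \<in> space M. X \<omega> $ 1 \<le> - t \<and> X \<omega> $ 2 \<le> - t}" for t
  have "(\<lambda>u. J (- inv F u) / u) \<sim>[at_right 0]
    (\<lambda>u. D * A powr (- \<gamma>) * u powr (\<gamma> - 1) * (- ln u / B) powr ((\<gamma> * m - n) / 2))"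
    using tq F_quantile tail quadrant pos
    by (intro asymp_equiv_at_gaussian_quantile[where G = "\<lambda>t. F (- t)"]) (simp_all add: F_def J_def)
  moreover have "\<forall>\<^sub>F u in at_right 0. J (- inv F u) / u = lower_tail_dependence M X u"
    using u_range
  proof eventually_elim
    fix u :: real assume "0 < u \<and> u < 1"
    then have "u = marginal_cdf M X 2 (inv F u)"
      unfolding F2 by (simp add: F_inv)
    also have "\<dots> = measure M {\<omega> \<in> space M. X \<omega> $ 2 \<le> inv F u}"
      unfolding marginal_cdf_def cdf_def2 using X_meas
      by (subst measure_distr) (auto intro!: arg_cong[where f = "measure M"])
    finally show "J (- inv F u) / u = lower_tail_dependence M X u"
      unfolding lower_tail_dependence_def cond_prob_def F1 F2 J_def by simp
  qed
  ultimately show ?thesis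
    by (rule asymp_equiv_transfer) auto
qed

section \<open>The lower tail dependence function\<close>

text \<open>
  The constants are linked by \<open>1 + lam\<^sup>2 = P / Q\<close>, \<open>1 + \<beta>\<^sup>2 = 2 Q / (1 + \<rho>)\<close>,
  \<open>\<alpha>\<^sup>2 (1 + lam\<^sup>2) = lam\<^sup>2\<close> and \<open>\<alpha> \<beta> = \<theta> sqrt (1 - \<rho>\<^sup>2)\<close>, with \<open>P\<close> and \<open>Q\<close> as in the proof. The first
  two show that the exponents of the quadrant probability and of the margin have ratio
  \<open>1 + \<beta>\<^sup>2\<close>, which is the origin of the power \<open>u powr \<beta>\<^sup>2\<close>.
\<close>
lemma skew_normal_constant_eq:
  fixes \<rho> \<theta> :: real
  assumes "-1 < \<rho>" "\<rho> < 1" "0 < \<theta>"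
  defines "lam \<equiv> \<theta> * (1 + \<rho>) / sqrt (1 + \<theta>\<^sup>2 * (1 - \<rho>\<^sup>2))"
    and "\<alpha> \<equiv> \<theta> * (1 + \<rho>) / sqrt (1 + 2 * \<theta>\<^sup>2 * (1 + \<rho>))"
    and "\<beta> \<equiv> sqrt ((1 - \<rho>) * (1 + 2 * \<theta>\<^sup>2 * (1 + \<rho>)) / (1 + \<rho>))"
  shows "0 < lam" and "0 < \<beta>"
    and "(1 + \<beta>\<^sup>2) * ((1 + lam\<^sup>2) / 2) = 1 / (1 + \<rho>) + 2 * \<theta>\<^sup>2"
    and "1 / (pi * sqrt (1 - \<rho>\<^sup>2)) * (1 / (\<theta> * sqrt (2 * pi)) / (2 ^ 1 * (1 / (1 + \<rho>) + 2 * \<theta>\<^sup>2)\<^sup>2))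
      = \<alpha> ^ 3 / (pi * lam ^ 4 * \<beta> * (1 + \<beta>\<^sup>2)\<^sup>2) * sqrt (2 / pi)"
proof -
  define P Q where "P = 1 + 2 * \<theta>\<^sup>2 * (1 + \<rho>)" and "Q = 1 + \<theta>\<^sup>2 * (1 - \<rho>\<^sup>2)"
  have "\<rho>\<^sup>2 < 1" using assms by (simp add: abs_square_less_1 abs_less_iff)
  then have pos: "0 < P" "0 < Q" "0 < 1 + \<rho>" "0 < 1 - \<rho>"
    using assms by (auto simp: P_def Q_def intro!: add_pos_nonneg)
  show lam_pos: "0 < lam"
    using pos assms(3) by (simp add: lam_def flip: Q_def)
  show \<beta>_pos: "0 < \<beta>"
    using pos by (simp add: \<beta>_def flip: P_def)
  have \<alpha>_pos: "0 < \<alpha>"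
    using pos assms(3) by (simp add: \<alpha>_def flip: P_def)
  have lam2: "lam\<^sup>2 = (\<theta> * (1 + \<rho>))\<^sup>2 / Q"
    using pos by (simp add: lam_def power_divide flip: Q_def)
  have \<alpha>2: "\<alpha>\<^sup>2 = (\<theta> * (1 + \<rho>))\<^sup>2 / P"
    using pos by (simp add: \<alpha>_def power_divide flip: P_def)
  have \<beta>2: "\<beta>\<^sup>2 = (1 - \<rho>) * P / (1 + \<rho>)"
    using pos by (simp add: \<beta>_def flip: P_def)
  have "Q + (\<theta> * (1 + \<rho>))\<^sup>2 = P"
    by (simp add: P_def Q_def power2_eq_square algebra_simps)
  then have lam2': "1 + lam\<^sup>2 = P / Q"
    unfolding lam2 using pos by (simp add: field_simps)
  have "1 + \<rho> + (1 - \<rho>) * P = 2 * Q"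
    by (simp add: P_def Q_def power2_eq_square algebra_simps)
  then have \<beta>2': "1 + \<beta>\<^sup>2 = 2 * Q / (1 + \<rho>)"
    unfolding \<beta>2 using pos by (simp add: field_simps)
  show K: "(1 + \<beta>\<^sup>2) * ((1 + lam\<^sup>2) / 2) = 1 / (1 + \<rho>) + 2 * \<theta>\<^sup>2"
  proof -
    have "1 / (1 + \<rho>) + 2 * \<theta>\<^sup>2 = P / (1 + \<rho>)"
      using pos by (simp add: P_def field_simps)
    then show ?thesis
      unfolding lam2' \<beta>2' using pos by simp
  qed
  have \<alpha>_lam: "\<alpha>\<^sup>2 * (1 + lam\<^sup>2) = lam\<^sup>2"
    unfolding lam2' \<alpha>2 unfolding lam2 using pos by simp
  have \<alpha>_\<beta>: "\<alpha> * \<beta> = \<theta> * sqrt (1 - \<rho>\<^sup>2)"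
  proof -
    have "\<alpha> * \<beta> = sqrt ((\<alpha> * \<beta>)\<^sup>2)"
      using \<alpha>_pos \<beta>_pos by simp
    also have "(\<alpha> * \<beta>)\<^sup>2 = \<theta>\<^sup>2 * (1 - \<rho>\<^sup>2)"
    proof -
      have "(\<theta> * (1 + \<rho>))\<^sup>2 = \<theta>\<^sup>2 * (1 + \<rho>) * (1 + \<rho>)"
        by (simp add: power2_eq_square)
      then have "(\<alpha> * \<beta>)\<^sup>2 = \<theta>\<^sup>2 * (1 + \<rho>) * (1 - \<rho>)"
        unfolding power_mult_distrib[of \<alpha> \<beta>] \<alpha>2 \<beta>2 using pos by simp
      then show ?thesis
        by (simp add: power2_eq_square algebra_simps)
    qed
    finally show ?thesis
      using assms(3) by (simp add: real_sqrt_mult)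
  qed
  have frac: "\<alpha> ^ 3 / (lam ^ 4 * \<beta>) = 1 / (\<theta> * sqrt (1 - \<rho>\<^sup>2) * (1 + lam\<^sup>2)\<^sup>2)"
  proof -
    have "lam ^ 4 = (\<alpha>\<^sup>2 * (1 + lam\<^sup>2))\<^sup>2"
      unfolding \<alpha>_lam by simp
    then have "lam ^ 4 * \<beta> = \<alpha> ^ 3 * (\<alpha> * \<beta> * (1 + lam\<^sup>2)\<^sup>2)"
      by (simp add: power_mult_distrib power2_eq_square power3_eq_cube)
    then show ?thesis
      using \<alpha>_pos by (simp add: \<alpha>_\<beta>)
  qed
  have "1 / sqrt (2 * pi) = sqrt (2 / pi) / 2"
    by (simp add: real_sqrt_divide real_sqrt_mult field_simps)
  then show "1 / (pi * sqrt (1 - \<rho>\<^sup>2)) * (1 / (\<theta> * sqrt (2 * pi)) / (2 ^ 1 * (1 / (1 + \<rho>) + 2 * \<theta>\<^sup>2)\<^sup>2))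
      = \<alpha> ^ 3 / (pi * lam ^ 4 * \<beta> * (1 + \<beta>\<^sup>2)\<^sup>2) * sqrt (2 / pi)"
  proof -
    have "\<alpha> ^ 3 / (pi * lam ^ 4 * \<beta> * (1 + \<beta>\<^sup>2)\<^sup>2) * sqrt (2 / pi)
        = \<alpha> ^ 3 / (lam ^ 4 * \<beta>) * (1 / (pi * (1 + \<beta>\<^sup>2)\<^sup>2)) * (2 * (1 / sqrt (2 * pi)))"
      unfolding \<open>1 / sqrt (2 * pi) = sqrt (2 / pi) / 2\<close> by simp
    also have "\<dots> = 1 / (pi * sqrt (1 - \<rho>\<^sup>2)) * (1 / (\<theta> * sqrt (2 * pi)) / (2 ^ 1 * ((1 + \<beta>\<^sup>2) * ((1 + lam\<^sup>2) / 2))\<^sup>2))"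
      unfolding frac by (simp add: power_mult_distrib power_divide)
    finally show ?thesis
      unfolding K ..
  qed
qed

text \<open>
  Both skewing factors decay like a Gaussian over its argument (\<open>k = 1\<close>), so \<open>m = 2\<close>, \<open>n = 3\<close> and
  \<open>\<gamma> = 1 + \<beta>\<^sup>2\<close>. The power \<open>3/2\<close> of \<open>(1 + lam\<^sup>2) / 2\<close> is what remains of \<open>B powr \<gamma>\<close> from the margin
  and \<open>B powr (1/2 - \<beta>\<^sup>2)\<close> from the logarithm.
\<close>
lemma lower_tail_dependence_pos:
  fixes \<theta> \<rho> :: real
  assumes M: "prob_space M" and \<rho>: "-1 < \<rho>" "\<rho> < 1"
    and X: "skew_normal_distributed M X (vector [\<theta>, \<theta>]) (equicorrelation_matrix \<rho>)" and "0 < \<theta>"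
  defines "lam \<equiv> \<theta> * (1 + \<rho>) / sqrt (1 + \<theta>\<^sup>2 * (1 - \<rho>\<^sup>2))"
    and "\<alpha> \<equiv> \<theta> * (1 + \<rho>) / sqrt (1 + 2 * \<theta>\<^sup>2 * (1 + \<rho>))"
    and "\<beta> \<equiv> sqrt ((1 - \<rho>) * (1 + 2 * \<theta>\<^sup>2 * (1 + \<rho>)) / (1 + \<rho>))"
  shows "lower_tail_dependence M X \<sim>[at_right 0]
          (\<lambda>u. u powr (\<beta>\<^sup>2) * (\<alpha> ^ 3 / (pi * lam ^ 4 * \<beta> * (1 + \<beta>\<^sup>2)\<^sup>2)) * sqrt (2 / pi)
               * (2 * pi * lam) powr (1 + \<beta>\<^sup>2) * ((1 + lam\<^sup>2) / 2) powr (3 / 2)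
               * (- ln u) powr (\<beta>\<^sup>2 - 1 / 2))"
proof -
  note const = skew_normal_constant_eq[OF \<rho> \<open>0 < \<theta>\<close>, folded lam_def \<alpha>_def \<beta>_def]
  define D where "D = 1 / (pi * sqrt (1 - \<rho>\<^sup>2)) * (1 / (\<theta> * sqrt (2 * pi)) / (2 ^ 1 * (1 / (1 + \<rho>) + 2 * \<theta>\<^sup>2)\<^sup>2))"
  define A where "A = 2 / sqrt (2 * pi) * (1 / (lam * sqrt (2 * pi)) / (1 + lam\<^sup>2))"
  define B where "B = (1 + lam\<^sup>2) / 2"
  have factor: "std_normal_cdf (\<delta> * s) = exp (- (\<delta>\<^sup>2 * s\<^sup>2 / 2)) * (exp (\<delta>\<^sup>2 * (- s)\<^sup>2 / 2) * std_normal_cdf (- \<delta> * - s))"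
    for \<delta> s :: real
    by (simp add: mult.assoc[symmetric] exp_add[symmetric])
  have marg: "regularly_decaying (\<lambda>z. exp (lam\<^sup>2 * z\<^sup>2 / 2) * std_normal_cdf (- lam * z)) 1
      (1 / (lam * sqrt (2 * pi))) (1 / (lam * sqrt (2 * pi)))"
    by (rule regularly_decaying_std_normal_cdf_pos[OF const(1)])
  have joint: "regularly_decaying (\<lambda>z. exp (\<theta>\<^sup>2 * z\<^sup>2 / 2) * std_normal_cdf (- \<theta> * z)) 1
      (1 / (\<theta> * sqrt (2 * pi))) (1 / (\<theta> * sqrt (2 * pi)))"
    by (rule regularly_decaying_std_normal_cdf_pos[OF \<open>0 < \<theta>\<close>])
  have "\<rho>\<^sup>2 < 1" using \<rho> by (simp add: abs_square_less_1 abs_less_iff)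
  have K_pos: "0 < 1 / (1 + \<rho>) + 2 * \<theta>\<^sup>2"
    using \<rho> by (intro add_pos_nonneg) auto
  have pos: "0 < A" "0 < B" "0 < D"
    using const(1) \<open>0 < \<theta>\<close> \<open>\<rho>\<^sup>2 < 1\<close> K_pos by (auto simp: A_def B_def D_def add_pos_nonneg)
  have A: "A = 1 / (2 * pi * lam * B)"
  proof -
    have "2 / a * (1 / (lam * a) / (2 * B)) = 1 / (a\<^sup>2 * lam * B)" for a :: real
      by (simp add: power2_eq_square)
    moreover have "1 + lam\<^sup>2 = 2 * B"
      by (simp add: B_def)
    ultimately show ?thesis
      unfolding A_def by simp
  qed
  have asymp: "lower_tail_dependence M X \<sim>[at_right 0]
    (\<lambda>u. D * A powr (- (1 + \<beta>\<^sup>2)) * u powr ((1 + \<beta>\<^sup>2) - 1)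
        * (- ln u / B) powr (((1 + \<beta>\<^sup>2) * (1 + 1 :: nat) - (1 + 2 :: nat)) / 2))"
  proof (rule lower_tail_dependence_asymp_equiv[OF M \<rho> X _ _ pos])
    show "((\<lambda>t. t ^ (1 + 1) * exp (B * t\<^sup>2) * cdf (distr M borel (\<lambda>\<omega>. X \<omega> $ 1)) (- t)) \<longlongrightarrow> A) at_top"
      unfolding A_def B_def
      by (rule skew_normal_tail_limit[OF marg skew_normal_marginal_distributed[OF \<rho> X, folded lam_def] factor]) simp
    show "((\<lambda>t. t ^ (1 + 2) * exp ((1 + \<beta>\<^sup>2) * B * t\<^sup>2) * measure M {\<omega> \<in> space M. X \<omega> $ 1 \<le> - t \<and> X \<omega> $ 2 \<le> - t}) \<longlongrightarrow> D) at_top"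
      unfolding D_def B_def const(3)
      by (rule skew_normal_quadrant_limit[OF joint \<rho> X factor]) simp
  qed
  have "\<forall>\<^sub>F u in at_right (0::real). 0 < u \<and> u < 1"
    by (auto simp: eventually_at_right_field intro: exI[of _ 1])
  then have eq: "\<forall>\<^sub>F u in at_right 0. D * A powr (- (1 + \<beta>\<^sup>2)) * u powr ((1 + \<beta>\<^sup>2) - 1)
        * (- ln u / B) powr (((1 + \<beta>\<^sup>2) * (1 + 1 :: nat) - (1 + 2 :: nat)) / 2)
      = u powr (\<beta>\<^sup>2) * (\<alpha> ^ 3 / (pi * lam ^ 4 * \<beta> * (1 + \<beta>\<^sup>2)\<^sup>2)) * sqrt (2 / pi)
               * (2 * pi * lam) powr (1 + \<beta>\<^sup>2) * ((1 + lam\<^sup>2) / 2) powr (3 / 2)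
               * (- ln u) powr (\<beta>\<^sup>2 - 1 / 2)"
  proof eventually_elim
    fix u :: real assume u: "0 < u \<and> u < 1"
    have A_powr: "A powr (- (1 + \<beta>\<^sup>2)) = (2 * pi * lam) powr (1 + \<beta>\<^sup>2) * B powr (1 + \<beta>\<^sup>2)"
    proof -
      have "(1 / x) powr (- g) = x powr g" if "0 < x" for x g :: real
        using that by (simp add: powr_minus_divide powr_divide)
      from this[of "2 * pi * lam * B" "1 + \<beta>\<^sup>2"]
      have "A powr (- (1 + \<beta>\<^sup>2)) = (2 * pi * lam * B) powr (1 + \<beta>\<^sup>2)"
        unfolding A using const(1) pos(2) by (simp only: zero_less_mult_iff pi_gt_zero zero_less_numeral) simp
      then show ?thesis
        using const(1) pos(2) by (simp only: powr_mult[of "2 * pi * lam" B])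
    qed
    have expo: "((1 + \<beta>\<^sup>2) * (1 + 1 :: nat) - (1 + 2 :: nat)) / 2 = \<beta>\<^sup>2 - 1 / 2"
      by (simp add: field_simps)
    have L_powr: "(- ln u / B) powr (\<beta>\<^sup>2 - 1 / 2) = (- ln u) powr (\<beta>\<^sup>2 - 1 / 2) * B powr - (\<beta>\<^sup>2 - 1 / 2)"
      using u pos(2) by (simp only: powr_divide powr_minus_divide) simp
    have B_powr: "B powr (1 + \<beta>\<^sup>2) * B powr - (\<beta>\<^sup>2 - 1 / 2) = B powr (3 / 2)"
      using pos(2) by (simp flip: powr_add)
    have "D * A powr (- (1 + \<beta>\<^sup>2)) * u powr ((1 + \<beta>\<^sup>2) - 1) * (- ln u / B) powr (\<beta>\<^sup>2 - 1 / 2)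
       = u powr (\<beta>\<^sup>2) * D * (2 * pi * lam) powr (1 + \<beta>\<^sup>2) * (B powr (1 + \<beta>\<^sup>2) * B powr - (\<beta>\<^sup>2 - 1 / 2))
          * (- ln u) powr (\<beta>\<^sup>2 - 1 / 2)"
      unfolding A_powr L_powr by (simp only: mult_ac add_diff_cancel_left')
    then show "D * A powr (- (1 + \<beta>\<^sup>2)) * u powr ((1 + \<beta>\<^sup>2) - 1)
        * (- ln u / B) powr (((1 + \<beta>\<^sup>2) * (1 + 1 :: nat) - (1 + 2 :: nat)) / 2)
      = u powr (\<beta>\<^sup>2) * (\<alpha> ^ 3 / (pi * lam ^ 4 * \<beta> * (1 + \<beta>\<^sup>2)\<^sup>2)) * sqrt (2 / pi)
               * (2 * pi * lam) powr (1 + \<beta>\<^sup>2) * ((1 + lam\<^sup>2) / 2) powr (3 / 2)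
               * (- ln u) powr (\<beta>\<^sup>2 - 1 / 2)"
      unfolding expo B_powr D_def const(4) B_def[symmetric] by (simp only: mult.assoc)
  qed
  show ?thesis
    by (rule asymp_equiv_transfer[OF asymp _ eq]) simp
qed

text \<open>
  Both skewing factors tend to 1 (\<open>k = 0\<close>, \<open>\<kappa> = 0\<close>), so the tails are, up to a factor 2, those of
  the unskewed normal law: \<open>m = 1\<close>, \<open>n = 2\<close> and \<open>\<gamma> = 2 / (1 + \<rho>)\<close>.
\<close>
lemma lower_tail_dependence_neg:
  fixes \<theta> \<rho> :: real
  assumes M: "prob_space M" and \<rho>: "-1 < \<rho>" "\<rho> < 1"
    and X: "skew_normal_distributed M X (vector [\<theta>, \<theta>]) (equicorrelation_matrix \<rho>)" and "\<theta> < 0"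
  shows "lower_tail_dependence M X \<sim>[at_right 0]
        (\<lambda>u. u powr ((1 - \<rho>) / (1 + \<rho>)) * ((1 + \<rho>) / 2) * sqrt ((1 + \<rho>) / (1 - \<rho>))
             * (- pi * ln u) powr (- \<rho> / (1 + \<rho>)))"
proof -
  define lam where "lam = \<theta> * (1 + \<rho>) / sqrt (1 + \<theta>\<^sup>2 * (1 - \<rho>\<^sup>2))"
  define \<gamma> where "\<gamma> = 2 / (1 + \<rho>)"
  define A where "A = 2 / sqrt (2 * pi) * (1 / (1 + 0))"
  define D where "D = 1 / (pi * sqrt (1 - \<rho>\<^sup>2)) * (1 / (2 ^ 0 * (1 / (1 + \<rho>) + 2 * 0)\<^sup>2))"
  have "\<rho>\<^sup>2 < 1" using \<rho> by (simp add: abs_square_less_1 abs_less_iff)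
  then have "lam < 0"
    using \<rho> \<open>\<theta> < 0\<close> by (auto simp: lam_def divide_less_0_iff mult_less_0_iff intro!: add_pos_nonneg)
  have factor: "std_normal_cdf (\<delta> * s) = exp (- (0 * s\<^sup>2 / 2)) * std_normal_cdf (- \<delta> * - s)" for \<delta> s :: real
    by simp
  have marg: "regularly_decaying (\<lambda>z. std_normal_cdf (- lam * z)) 0 1 1"
    by (rule regularly_decaying_std_normal_cdf_neg[OF \<open>lam < 0\<close>])
  have joint: "regularly_decaying (\<lambda>z. std_normal_cdf (- \<theta> * z)) 0 1 1"
    by (rule regularly_decaying_std_normal_cdf_neg[OF \<open>\<theta> < 0\<close>])
  have pos: "0 < A" "(0::real) < (1 + 0) / 2" "0 < D"
    using \<open>\<rho>\<^sup>2 < 1\<close> \<rho> by (auto simp: A_def D_def)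
  have K: "\<gamma> * ((1 + 0) / 2) = 1 / (1 + \<rho>) + 2 * 0"
    using \<rho> by (simp add: \<gamma>_def field_simps)
  have asymp: "lower_tail_dependence M X \<sim>[at_right 0]
    (\<lambda>u. D * A powr (- \<gamma>) * u powr (\<gamma> - 1)
        * (- ln u / ((1 + 0) / 2)) powr ((\<gamma> * (0 + 1 :: nat) - (0 + 2 :: nat)) / 2))"
  proof (rule lower_tail_dependence_asymp_equiv[OF M \<rho> X _ _ pos])
    show "((\<lambda>t. t ^ (0 + 1) * exp ((1 + 0) / 2 * t\<^sup>2) * cdf (distr M borel (\<lambda>\<omega>. X \<omega> $ 1)) (- t)) \<longlongrightarrow> A) at_top"
      unfolding A_def
      by (rule skew_normal_tail_limit[OF marg skew_normal_marginal_distributed[OF \<rho> X, folded lam_def] factor]) simp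
    show "((\<lambda>t. t ^ (0 + 2) * exp (\<gamma> * ((1 + 0) / 2) * t\<^sup>2) * measure M {\<omega> \<in> space M. X \<omega> $ 1 \<le> - t \<and> X \<omega> $ 2 \<le> - t}) \<longlongrightarrow> D) at_top"
      unfolding D_def K by (rule skew_normal_quadrant_limit[OF joint \<rho> X factor]) simp
  qed
  have "\<forall>\<^sub>F u in at_right (0::real). 0 < u \<and> u < 1"
    by (auto simp: eventually_at_right_field intro: exI[of _ 1])
  then have eq: "\<forall>\<^sub>F u in at_right 0. D * A powr (- \<gamma>) * u powr (\<gamma> - 1)
        * (- ln u / ((1 + 0) / 2)) powr ((\<gamma> * (0 + 1 :: nat) - (0 + 2 :: nat)) / 2)
      = u powr ((1 - \<rho>) / (1 + \<rho>)) * ((1 + \<rho>) / 2) * sqrt ((1 + \<rho>) / (1 - \<rho>))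
             * (- pi * ln u) powr (- \<rho> / (1 + \<rho>))"
  proof eventually_elim
    fix u :: real assume u: "0 < u \<and> u < 1"
    have exps: "\<gamma> - 1 = (1 - \<rho>) / (1 + \<rho>)" "(\<gamma> * (0 + 1 :: nat) - (0 + 2 :: nat)) / 2 = - \<rho> / (1 + \<rho>)"
        "\<gamma> / 2 = 1 + - \<rho> / (1 + \<rho>)"
      using \<rho> by (simp_all add: \<gamma>_def field_simps)
    have "A = (pi / 2) powr - (1 / 2)"
      by (simp add: A_def powr_minus_divide powr_half_sqrt real_sqrt_divide real_sqrt_mult field_simps)
    then have "A powr (- \<gamma>) = (pi / 2) powr (\<gamma> / 2)"
      by (simp add: powr_powr)
    also have "\<dots> = pi / 2 * (pi / 2) powr (- \<rho> / (1 + \<rho>))"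
      unfolding exps(3) powr_add by simp
    finally have A_powr: "A powr (- \<gamma>) = \<dots>" .
    have L: "(pi / 2) powr (- \<rho> / (1 + \<rho>)) * (- ln u / ((1 + 0) / 2)) powr (- \<rho> / (1 + \<rho>))
        = (- pi * ln u) powr (- \<rho> / (1 + \<rho>))"
      using u by (subst powr_mult[symmetric]) auto
    have D: "D * (pi / 2) = (1 + \<rho>) / 2 * sqrt ((1 + \<rho>) / (1 - \<rho>))"
    proof -
      have "sqrt (1 - \<rho>\<^sup>2) = sqrt (1 + \<rho>) * sqrt (1 - \<rho>)"
        by (simp add: power2_eq_square algebra_simps flip: real_sqrt_mult)
      moreover have "(1 + \<rho>)\<^sup>2 / (sqrt (1 + \<rho>) * sqrt (1 - \<rho>)) = (1 + \<rho>) * (sqrt (1 + \<rho>) / sqrt (1 - \<rho>))"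
      proof -
        have "(1 + \<rho>) / sqrt (1 + \<rho>) = sqrt (1 + \<rho>)"
          using \<rho> by (intro real_div_sqrt) auto
        moreover have "(1 + \<rho>)\<^sup>2 / (a * b) = (1 + \<rho>) * ((1 + \<rho>) / a / b)" for a b
          by (simp add: power2_eq_square)
        ultimately show ?thesis
          by (simp only:)
      qed
      ultimately show ?thesis
        by (simp add: D_def real_sqrt_divide power_divide)
    qed
    have "D * A powr (- \<gamma>) * u powr (\<gamma> - 1) * (- ln u / ((1 + 0) / 2)) powr (- \<rho> / (1 + \<rho>))
        = u powr (\<gamma> - 1) * (D * (pi / 2)) *
          ((pi / 2) powr (- \<rho> / (1 + \<rho>)) * (- ln u / ((1 + 0) / 2)) powr (- \<rho> / (1 + \<rho>)))"
      unfolding A_powr by (simp only: mult_ac)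
    then show "D * A powr (- \<gamma>) * u powr (\<gamma> - 1)
        * (- ln u / ((1 + 0) / 2)) powr ((\<gamma> * (0 + 1 :: nat) - (0 + 2 :: nat)) / 2)
      = u powr ((1 - \<rho>) / (1 + \<rho>)) * ((1 + \<rho>) / 2) * sqrt ((1 + \<rho>) / (1 - \<rho>))
             * (- pi * ln u) powr (- \<rho> / (1 + \<rho>))"
      unfolding L D exps(1,2) by (simp only: mult.assoc)
  qed
  show ?thesis
    by (rule asymp_equiv_transfer[OF asymp _ eq]) simp
qed

theorem theorem2:
  fixes M :: "'a measure" and X :: "'a \<Rightarrow> real^2" and \<theta> \<rho> :: real
  assumes "prob_space M"
    and "-1 < \<rho>" and "\<rho> < 1"
    and "skew_normal_distributed M X (vector [\<theta>, \<theta>]) (vector [vector [1, \<rho>], vector [\<rho>, 1]])"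
  shows "(\<theta> > 0 \<longrightarrow>
      (let lam = \<theta> * (1 + \<rho>) / sqrt (1 + \<theta>\<^sup>2 * (1 - \<rho>\<^sup>2));
           \<alpha> = \<theta> * (1 + \<rho>) / sqrt (1 + 2 * \<theta>\<^sup>2 * (1 + \<rho>));
           \<beta> = sqrt ((1 - \<rho>) * (1 + 2 * \<theta>\<^sup>2 * (1 + \<rho>)) / (1 + \<rho>))
       in lower_tail_dependence M X \<sim>[at_right 0]
          (\<lambda>u. u powr (\<beta>\<^sup>2) * (\<alpha> ^ 3 / (pi * lam ^ 4 * \<beta> * (1 + \<beta>\<^sup>2)\<^sup>2)) * sqrt (2 / pi)
               * (2 * pi * lam) powr (1 + \<beta>\<^sup>2) * ((1 + lam\<^sup>2) / 2) powr (3 / 2)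
               * (- ln u) powr (\<beta>\<^sup>2 - 1 / 2)))) \<and>
    (\<theta> < 0 \<longrightarrow>
      lower_tail_dependence M X \<sim>[at_right 0]
        (\<lambda>u. u powr ((1 - \<rho>) / (1 + \<rho>)) * ((1 + \<rho>) / 2) * sqrt ((1 + \<rho>) / (1 - \<rho>))
             * (- pi * ln u) powr (- \<rho> / (1 + \<rho>))))"
  unfolding Let_def
  using lower_tail_dependence_pos lower_tail_dependence_neg assms
  unfolding equicorrelation_matrix_def by blast

end
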